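(* Let $k$ be a field and let $K$ be a field extension of $k$. Then $\mathrm{Ld}^*(K)=\mathrm{GKdim}(K)$.
   Context: $K$ is regarded as a $k$-algebra. A subframe of a $k$-algebra $A$ is a finite-dimensional $k$-subspace of $A$ containing $1$. For a $k$-algebra $A$ that is a domain and a subframe $V$ of $A$, $\mathrm{VDI}^*(V)\in[0,\infty]$ is the supremum of all real $d>0$ for which there is a constant $C>0$ with $\max(\dim_k(VW),\dim_k(WV))\ge \dim_k(W)+C\,(\dim_k W)^{(d-1)/d}$ for every subframe $W$ of $A$ (and $0$ if there is no such $d$). The strong lower transcendence degree is $\mathrm{Ld}^*(A)=\sup_V\mathrm{VDI}^*(V)$ over all subframes $V$ of $A$. Here $VW$ is the $k$-span of the products $vw$. For a finitely generated $k$-algebra $B$, $\mathrm{GKdim}(B)=\limsup_{n\to\infty}\frac{\log \dim_k V^n}{\log n}$ for any finite-dimensional subspace $V\ni 1$ generating $B$; in general, $\mathrm{GKdim}(A)$ is the supremum of $\mathrm{GKdim}(B)$ over the finitely generated $k$-subalgebras $B$ of $A$. *)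

theory Defs
  imports "HOL-Analysis.Analysis"
begin

locale k_algebra = vector_space scale
  for scale :: "'k::field \<Rightarrow> 'a::ring_1 \<Rightarrow> 'a"  (infixr \<open>*k\<close> 75) +
  assumes mult_scale_left: "(c *k x) * y = c *k (x * y)"
    and mult_scale_right: "x * (c *k y) = c *k (x * y)"
begin

definition subframe :: "'a set \<Rightarrow> bool" where
  "subframe V \<longleftrightarrow> subspace V \<and> 1 \<in> V \<and> (\<exists>S. finite S \<and> V = span S)"

definition sprod :: "'a set \<Rightarrow> 'a set \<Rightarrow> 'a set" where
  "sprod V W = span {v * w | v w. v \<in> V \<and> w \<in> W}"

primrec spower :: "'a set \<Rightarrow> nat \<Rightarrow> 'a set" where
  "spower V 0 = span {1}"
| "spower V (Suc n) = sprod V (spower V n)"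

text \<open>The strong lower transcendence degree. It is only considered for domains. The element 0
  inserted under the supremum supplies the value 0 when no exponent is admissible, the supremum of
  the empty set in \<^typ>\<open>ereal\<close> being minus infinity.\<close>

definition VDI_star :: "'a set \<Rightarrow> ereal" where
  "VDI_star V = Sup (insert 0 {ereal d | d. d > 0 \<and>
     (\<exists>C>0. \<forall>W. subframe W \<longrightarrow>
        real (max (dim (sprod V W)) (dim (sprod W V)))
          \<ge> real (dim W) + C * real (dim W) powr ((d - 1) / d))})"

definition Ld_star :: ereal where
  "Ld_star = (SUP V \<in> {V. subframe V}. VDI_star V)"

definition subalgebra :: "'a set \<Rightarrow> bool" where
  "subalgebra B \<longleftrightarrow> subspace B \<and> 1 \<in> B \<and> (\<forall>x\<in>B. \<forall>y\<in>B. x * y \<in> B)"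

definition fg_subalgebra :: "'a set \<Rightarrow> bool" where
  "fg_subalgebra B \<longleftrightarrow> (\<exists>S. finite S \<and> B = subalgebra hull S)"

definition growth_exponent :: "'a set \<Rightarrow> ereal" where
  "growth_exponent V = limsup (\<lambda>n. ereal (ln (real (dim (spower V n))) / ln (real n)))"

text \<open>The choice of the generating subframe is immaterial and always possible: see
  \<open>GKdim_fg_eq\<close> and \<open>fg_subalgebra_iff\<close> below.\<close>

definition GKdim_fg :: "'a set \<Rightarrow> ereal" where
  "GKdim_fg B = growth_exponent (SOME V. subframe V \<and> subalgebra hull V = B)"

definition GKdim :: ereal where
  "GKdim = (SUP B \<in> {B. fg_subalgebra B}. GKdim_fg B)"

end

context k_algebra
begin

lemma subalgebra_hull: "subalgebra (subalgebra hull S)"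
  by (rule hull_in) (auto simp: subalgebra_def intro: subspace_Inter)

lemma fg_subalgebra_iff:
  "fg_subalgebra B \<longleftrightarrow> (\<exists>V. subframe V \<and> subalgebra hull V = B)"
proof
  assume "fg_subalgebra B"
  then obtain S where S: "finite S" "B = subalgebra hull S" by (auto simp: fg_subalgebra_def)
  let ?V = "span (insert 1 S)"
  have "subframe ?V"
    using S(1) by (auto simp: subframe_def intro!: span_base exI[of _ "insert 1 S"])
  moreover have "subalgebra hull ?V = B"
  proof
    have "span (insert 1 S) \<subseteq> B"
      using subalgebra_hull[of S] hull_subset[of S subalgebra] S(2)
      by (intro span_minimal) (auto simp: subalgebra_def)
    then show "subalgebra hull ?V \<subseteq> B"
      using subalgebra_hull[of S] S(2) by (intro hull_minimal) auto
    have "S \<subseteq> ?V" by (auto intro: span_base)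
    then show "B \<subseteq> subalgebra hull ?V" unfolding S(2) by (rule hull_mono)
  qed
  ultimately show "\<exists>V. subframe V \<and> subalgebra hull V = B" by blast
next
  assume "\<exists>V. subframe V \<and> subalgebra hull V = B"
  then obtain V S where V: "subframe V" "subalgebra hull V = B" "finite S" "V = span S"
    by (auto simp: subframe_def)
  have "subalgebra hull S = B"
  proof
    show "subalgebra hull S \<subseteq> B"
      unfolding V(2)[symmetric] V(4) by (rule hull_mono) (rule span_superset)
    have "span S \<subseteq> subalgebra hull S"
      using subalgebra_hull[of S] hull_subset[of S subalgebra]
      by (intro span_minimal) (auto simp: subalgebra_def)
    then show "B \<subseteq> subalgebra hull S"
      unfolding V(2)[symmetric] V(4) by (rule hull_minimal) (rule subalgebra_hull)
  qed
  then show "fg_subalgebra B" using V(3) by (auto simp: fg_subalgebra_def)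
qed

lemma sprod_mono: "V \<subseteq> V' \<Longrightarrow> W \<subseteq> W' \<Longrightarrow> sprod V W \<subseteq> sprod V' W'"
  unfolding sprod_def by (rule span_mono) blast

lemma sprod_mem: "v \<in> V \<Longrightarrow> w \<in> W \<Longrightarrow> v * w \<in> sprod V W"
  unfolding sprod_def by (rule span_base) blast

lemma subspace_spower: "subspace (spower V n)"
  by (cases n) (auto simp: sprod_def)

lemma span_mult_mem:
  assumes U: "subspace U" and AB: "\<And>a b. a \<in> A \<Longrightarrow> b \<in> B \<Longrightarrow> a * b \<in> U"
    and x: "x \<in> span A" and y: "y \<in> span B"
  shows "x * y \<in> U"
proof -
  have 1: "a * y \<in> U" if a: "a \<in> A" for a
    using y
  proof (rule span_induct)
    show "subspace {b. a * b \<in> U}"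
      using U by (auto simp: subspace_def distrib_left mult_scale_right)
  qed (use AB a in auto)
  show ?thesis
    using x
  proof (rule span_induct)
    show "subspace {a. a * y \<in> U}"
      using U by (auto simp: subspace_def distrib_right mult_scale_left)
  qed (use 1 in auto)
qed

lemma spower_mult: "x \<in> spower V m \<Longrightarrow> y \<in> spower V n \<Longrightarrow> x * y \<in> spower V (m + n)"
proof (induction m arbitrary: x y)
  case 0
  show ?case
    by (rule span_mult_mem[of _ "{1}" "spower V n"])
      (use 0 subspace_spower in \<open>auto intro: span_base\<close>)
next
  case (Suc m)
  show ?case
  proof (rule span_mult_mem[of _ "{v * w | v w. v \<in> V \<and> w \<in> spower V m}" "spower V n"])
    fix a b assume "a \<in> {v * w | v w. v \<in> V \<and> w \<in> spower V m}" and b: "b \<in> spower V n"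
    then obtain v w where "v \<in> V" "w \<in> spower V m" "a = v * w" by blast
    then show "a * b \<in> spower V (Suc m + n)"
      using sprod_mem[of v V "w * b"] Suc.IH[OF _ b] by (simp add: mult.assoc)
  qed (use Suc.prems subspace_spower in \<open>auto simp: sprod_def intro: span_base\<close>)
qed

lemma subframe_subset_spower_1:
  assumes "subframe V"
  shows "V \<subseteq> spower V 1"
  using sprod_mem[of _ V 1 "span {1}"] span_base[of 1 "{1}"] by auto

lemma spower_Suc_mono: "1 \<in> V \<Longrightarrow> spower V n \<subseteq> spower V (Suc n)"
  using sprod_mem[of 1 V _ "spower V n"] by auto

lemma spower_mono:
  assumes "1 \<in> V" "m \<le> n"
  shows "spower V m \<subseteq> spower V n"
  by (rule lift_Suc_mono_le[OF _ assms(2)]) (rule spower_Suc_mono[OF assms(1)])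

lemma one_mem_spower: "1 \<in> V \<Longrightarrow> 1 \<in> spower V n"
  using spower_mono[of V 0 n] span_base[of 1 "{1}"] by auto

lemma hull_subset_spower:
  assumes V: "subframe V"
  shows "subalgebra hull V \<subseteq> (\<Union>n. spower V n)"
proof (rule hull_minimal)
  have 1: "1 \<in> V" using V by (simp add: subframe_def)
  show "V \<subseteq> (\<Union>n. spower V n)" using subframe_subset_spower_1[OF V] by blast
  have "x + y \<in> (\<Union>n. spower V n)" if "x \<in> spower V m" "y \<in> spower V n" for x y m n
  proof -
    have "x \<in> spower V (max m n)" "y \<in> spower V (max m n)"
      using that spower_mono[OF 1] by (meson max.cobounded1 max.cobounded2 subsetD)+
    then show ?thesis using subspace_spower by (auto intro: subspace_add)
  qed
  moreover have "c *k x \<in> (\<Union>n. spower V n)" if "x \<in> spower V m" for x c m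
    using that subspace_spower by (auto intro: subspace_scale)
  moreover have "x * y \<in> (\<Union>n. spower V n)" if "x \<in> spower V m" "y \<in> spower V n" for x y m n
    using spower_mult[OF that] by blast
  ultimately show "subalgebra (\<Union>n. spower V n)"
    using one_mem_spower[OF 1] subspace_0[OF subspace_spower]
    by (fastforce simp: subalgebra_def subspace_def)
qed

lemma finite_spanning_spower:
  assumes V: "subframe V"
  shows "\<exists>S. finite S \<and> spower V n = span S"
proof (induction n)
  case 0
  then show ?case by (auto intro: exI[of _ "{1}"])
next
  case (Suc n)
  then obtain S T where S: "finite S" "spower V n = span S" and T: "finite T" "V = span T"
    using V by (auto simp: subframe_def)
  let ?P = "(\<lambda>(a, b). a * b) ` (T \<times> S)"
  have "sprod V (spower V n) = span ?P"
  proof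
    have "v * w \<in> span ?P" if "v \<in> V" "w \<in> spower V n" for v w
    proof (rule span_mult_mem[of _ T S])
      show "a * b \<in> span ?P" if "a \<in> T" "b \<in> S" for a b
        using that by (force intro: span_base)
    qed (use that S(2) T(2) in simp_all)
    then show "sprod V (spower V n) \<subseteq> span ?P"
      unfolding sprod_def by (intro span_minimal) auto
    have "T \<subseteq> V" "S \<subseteq> spower V n"
      unfolding S(2) using T(2) span_superset by blast+
    then show "span ?P \<subseteq> sprod V (spower V n)"
      unfolding sprod_def by (intro span_mono) auto
  qed
  moreover have "finite ?P" using S(1) T(1) by simp
  ultimately show ?case unfolding spower.simps by blast
qed

lemma dim_mono_finite:
  assumes "V \<subseteq> span S" "finite S"
  shows "dim V \<le> dim (span S)"
proof -
  obtain B where B: "B \<subseteq> span S" "independent B" "span S \<subseteq> span B" "card B = dim (span S)"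
    using basis_exists by blast
  have "finite B" using independent_span_bound[OF assms(2) B(2,1)] by blast
  then show ?thesis using dim_le_card[of V B] B assms(1) by auto
qed

lemma dim_spower_pos:
  assumes "subframe V"
  shows "dim (spower V n) \<ge> 1"
proof -
  obtain S where S: "finite S" "spower V n = span S" using finite_spanning_spower[OF assms] by blast
  have "1 \<in> span S" using one_mem_spower[of V n] assms S by (auto simp: subframe_def)
  then have "dim {1} \<le> dim (span S)" using S(1) by (intro dim_mono_finite) auto
  moreover have "independent {1::'a}" using dependent_single by simp
  ultimately show ?thesis using S(2) dim_eq_card_independent[of "{1}"] by simp
qed

lemma growth_exponent_mono:
  assumes V: "subframe V" and W: "subframe W" and sub: "W \<subseteq> subalgebra hull V"
  shows "growth_exponent W \<le> growth_exponent V"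
proof -
  have V1: "1 \<in> V" using V by (simp add: subframe_def)
  obtain S where S: "finite S" "W = span S" using W by (auto simp: subframe_def)
  have "S \<subseteq> (\<Union>n. spower V n)"
    using hull_subset_spower[OF V] sub S span_superset by blast
  then have "\<exists>f. \<forall>s\<in>S. s \<in> spower V (f s)" by (auto intro!: bchoice)
  then obtain f where f: "\<And>s. s \<in> S \<Longrightarrow> s \<in> spower V (f s)" by blast
  define m where "m = Suc (sum f S)"
  have m0: "m > 0" by (simp add: m_def)
  have "f s \<le> m" if "s \<in> S" for s
    using member_le_sum[OF that, of f] S(1) by (simp add: m_def)
  then have "S \<subseteq> spower V m" using f spower_mono[OF V1] by blast
  then have Wm: "W \<subseteq> spower V m" unfolding S(2) by (rule span_minimal) (rule subspace_spower)
  have pow: "spower W n \<subseteq> spower V (m * n)" for n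
  proof (induction n)
    case (Suc n)
    show ?case unfolding spower.simps sprod_def
      by (rule span_minimal)
        (use spower_mult[of _ V m _ "m * n"] Wm Suc subspace_spower in auto)
  qed simp
  have dim_le: "dim (spower W n) \<le> dim (spower V (m * n))" for n
    using dim_mono_finite[of "spower W n"] pow[of n] finite_spanning_spower[OF V, of "m * n"] by auto
  show ?thesis
  proof (rule ereal_le_real)
    fix c assume "growth_exponent V \<le> ereal c"
    have "growth_exponent W \<le> ereal c + ereal e" if e: "e > 0" for e
    proof -
      let ?c = "c + e / 2"
      have "growth_exponent V < ereal ?c"
        using \<open>growth_exponent V \<le> ereal c\<close> e by (auto intro: le_less_trans)
      then have "eventually (\<lambda>n. ereal (ln (real (dim (spower V n))) / ln (real n)) < ereal ?c)
          sequentially"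
        unfolding growth_exponent_def by (rule Limsup_lessD)
      moreover have "filterlim (\<lambda>n. m * n) at_top sequentially"
        by (rule filterlim_subseq) (simp add: strict_mono_def m0)
      ultimately have 1: "eventually (\<lambda>n. ln (real (dim (spower V (m * n)))) / ln (real (m * n)) < ?c)
          sequentially"
        by (auto simp: filterlim_iff)
      have "(\<lambda>n. ?c * ln (real m) / ln (real n)) \<longlonglongrightarrow> 0"
        by (intro real_tendsto_divide_at_top[OF tendsto_const]
          filterlim_compose[OF ln_at_top filterlim_real_sequentially])
      then have 2: "eventually (\<lambda>n. ?c * ln (real m) / ln (real n) < e / 2) sequentially"
        by (rule order_tendstoD) (use e in simp)
      have "eventually (\<lambda>n. ereal (ln (real (dim (spower W n))) / ln (real n)) \<le> ereal (c + e))
          sequentially"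
        using 1 2 eventually_ge_at_top[of 2]
      proof eventually_elim
        case (elim n)
        have n: "ln (real n) > 0" using elim(3) by simp
        have mn: "ln (real (m * n)) = ln (real m) + ln (real n)"
          using elim(3) m0 by (simp add: ln_mult)
        have m: "ln (real m) \<ge> 0" using m0 by simp
        have "ln (real (dim (spower W n))) \<le> ln (real (dim (spower V (m * n))))"
          using dim_le[of n] dim_spower_pos[OF W, of n] by (subst ln_le_cancel_iff) auto
        also have "\<dots> \<le> ?c * (ln (real m) + ln (real n))"
          using elim(1) n m unfolding mn by (simp add: pos_divide_less_eq less_imp_le)
        also have "\<dots> = ?c * ln (real m) + ?c * ln (real n)" by (simp add: algebra_simps)
        also have "\<dots> \<le> e / 2 * ln (real n) + ?c * ln (real n)"
          using elim(2) n by (simp add: pos_divide_less_eq less_imp_le)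
        also have "\<dots> = (c + e) * ln (real n)" by (simp add: algebra_simps)
        finally show ?case using n by (simp add: pos_divide_le_eq)
      qed
      then show ?thesis unfolding growth_exponent_def by (intro Limsup_bounded) simp
    qed
    then show "growth_exponent W \<le> ereal c" by (rule ereal_le_epsilon2[OF _]) simp
  qed
qed

lemma GKdim_fg_eq:
  assumes "subframe V" "subalgebra hull V = B"
  shows "GKdim_fg B = growth_exponent V"
proof -
  let ?P = "\<lambda>V. subframe V \<and> subalgebra hull V = B"
  have P: "?P (Eps ?P)" using someI[of ?P V] assms by blast
  show ?thesis
    unfolding GKdim_fg_def
    using P assms hull_subset[of V subalgebra] hull_subset[of "Eps ?P" subalgebra]
    by (simp add: order_antisym growth_exponent_mono)
qed

end

text \<open>A field extension is given by an embedding of the base field.\<close>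

locale field_embedding =
  fixes \<iota> :: "'k::field \<Rightarrow> 'K::field"
  assumes emb_add: "\<iota> (a + b) = \<iota> a + \<iota> b"
    and emb_mult: "\<iota> (a * b) = \<iota> a * \<iota> b"
    and emb_one: "\<iota> 1 = 1"

sublocale field_embedding \<subseteq> k_algebra "\<lambda>c x. \<iota> c * x"
  by unfold_locales (simp_all add: emb_add emb_mult emb_one algebra_simps)

end

theory Submission
  imports Defs "HOL-Library.List_Lexorder"
begin

text \<open>Both invariants count algebraically independent elements. The proof compares them in two
inequalities.

\<^emph>\<open>The invariant \<open>Ld\<^sup>*\<close> is at most \<open>GKdim\<close>.\<close> An isoperimetric inequality for a subframe \<open>V\<close>,
applied to its own powers, says that \<open>f n = dim V\<^sup>n\<close> satisfies
\<open>f (n + 1) \<ge> f n + C (f n powr (1 - 1 / d))\<close>. This is a discrete form of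
\<open>y' = C (y powr (1 - 1 / d))\<close>, whose solutions grow like the \<open>d\<close>-th power of \<open>n\<close>, so the growth
exponent of \<open>V\<close> is at least \<open>d\<close> (\<open>limsup_log_ratio_ge\<close>).

\<^emph>\<open>The invariant \<open>GKdim\<close> is at most \<open>Ld\<^sup>*\<close>.\<close> Let \<open>V\<close> be spanned by a finite set \<open>S\<close>, and let \<open>xs\<close>
consist of \<open>d\<close> algebraically independent elements such that \<open>S\<close> is algebraic over the polynomial
ring \<open>P = k[xs]\<close>. Up to a common denominator \<open>q\<close>, multiplication by elements of \<open>S\<close> maps a module
generated by a finite set over \<open>P\<close> into itself and raises degrees by a bounded amount
(\<open>finite_over_alg_indep\<close>). Hence \<open>dim V\<^sup>n\<close> is at most a constant times \<open>n\<^sup>d\<close>. For \<open>d = 0\<close>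
nothing more is needed, since \<open>Ld\<^sup>*\<close> is nonnegative. For \<open>d \<ge> 1\<close> it remains to see that the span \<open>X\<close> of \<open>1\<close> and \<open>xs\<close> satisfies an isoperimetric inequality of exponent \<open>d\<close> against every
finite-dimensional subspace \<open>W\<close> of the whole field, not only against subspaces of \<open>P\<close>.

Such a \<open>W\<close> lies in a free \<open>P\<close>-module of finite rank (\<open>free_envelope\<close>), because denominators can be
cleared. That module has a \<open>k\<close>-basis indexed by several copies of the lattice of exponents, and
multiplication by a member of \<open>xs\<close> moves one step in a coordinate direction. For a lexicographic
order, the dimension of \<open>W\<close> is the number of leading indices of its elements, and the leading
indices of \<open>XW\<close> contain those of \<open>W\<close> together with all their translates. So the claim reduces to an
isoperimetric inequality for finite sets of lattice points (\<open>lattice_isoperimetric\<close>), which holds with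
the constant \<open>1\<close>.\<close>

section \<open>Growth of integer sequences\<close>

text \<open>The map \<open>y \<mapsto> y powr (1 / d)\<close> turns the growth law \<open>y' = C (y powr (1 - 1 / d))\<close> into growth at
the constant rate \<open>C / d\<close>. In the discrete setting a rate of half that size survives, provided that \<open>C\<close> is first cut
down to \<open>1\<close>: this keeps the exponent \<open>s\<close> below within the range where \<open>exp s \<le> 1 + 2 s\<close>.\<close>

lemma root_growth_step:
  fixes C d x :: real
  assumes C: "C > 0" and d: "d > 0" and x: "x \<ge> 1"
  shows "x powr (1 / d) + min C 1 / (2 * d) \<le> (x + C * x powr ((d - 1) / d)) powr (1 / d)"
proof -
  define u c t where "u = x powr (1 / d)" and "c = min C 1 / (2 * d)" and "t = 1 / u"
  have u: "u \<ge> 1" using x d by (simp add: u_def ge_one_powr_ge_zero)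
  have c: "c > 0" using C d by (simp add: c_def)
  have t: "0 < t" "t \<le> 1" using u by (auto simp: t_def)
  define s where "s = d * (c * t)"
  have s: "s = min C 1 * t / 2" using d by (simp add: s_def c_def)
  have s1: "0 \<le> s" "s \<le> 1" "2 * s \<le> C * t"
    using t C mult_right_mono[of "min C 1" C t] mult_le_one[of "min C 1" t]
    by (auto simp: s)
  have "(1 + c * t) powr d = exp (d * ln (1 + c * t))"
    using c t add_pos_pos[of 1 "c * t"] by (simp add: powr_def)
  also have "\<dots> \<le> exp s"
    using ln_add_one_self_le_self[of "c * t"] c t d by (simp add: s_def)
  also have "\<dots> \<le> 1 + s + s\<^sup>2" using s1 by (intro exp_bound)
  also have "\<dots> \<le> 1 + 2 * s"
    using s1 by (simp add: power2_eq_square mult_left_le)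
  finally have 1: "(1 + c * t) powr d \<le> 1 + C * t" using s1 by simp
  have xu: "u powr d = x" using x d by (simp add: u_def powr_powr)
  have xt: "x * t = x powr ((d - 1) / d)"
    using x d powr_diff[of x 1 "1/d"] by (simp add: t_def u_def diff_divide_distrib)
  have "u + c = u * (1 + c * t)" using u by (simp add: t_def field_simps)
  then have "(u + c) powr d = x * (1 + c * t) powr d"
    using u c t xu by (simp add: powr_mult)
  also have "\<dots> \<le> x * (1 + C * t)" using x by (intro mult_left_mono[OF 1]) simp
  also have "\<dots> = x + C * x powr ((d - 1) / d)" by (simp add: distrib_left xt[symmetric] mult_ac)
  finally have "((u + c) powr d) powr (1 / d) \<le> (x + C * x powr ((d - 1) / d)) powr (1 / d)"
    using d by (intro powr_mono2) auto
  then show ?thesis using u c d by (simp add: powr_powr u_def c_def)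
qed

text \<open>By the preceding lemma the \<open>d\<close>-th root of \<open>f n\<close> is at least \<open>c n\<close>, and the factor \<open>c\<close> does not
influence the limit of the quotient of logarithms.\<close>

lemma limsup_log_ratio_ge:
  fixes f :: "nat \<Rightarrow> nat" and C d :: real
  assumes C: "C > 0" and d: "d > 0" and pos: "\<And>n. f n \<ge> 1"
    and step: "\<And>n. real (f (Suc n)) \<ge> real (f n) + C * real (f n) powr ((d - 1) / d)"
  shows "ereal d \<le> limsup (\<lambda>n. ereal (ln (real (f n)) / ln (real n)))"
proof -
  define c where "c = min C 1 / (2 * d)"
  have c: "c > 0" using C d by (simp add: c_def)
  have lower: "c * real n \<le> real (f n) powr (1 / d)" for n
  proof (induction n)
    case (Suc n)
    have "c * real (Suc n) \<le> real (f n) powr (1 / d) + c"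
      using Suc by (simp add: distrib_left)
    also have "\<dots> \<le> (real (f n) + C * real (f n) powr ((d - 1) / d)) powr (1 / d)"
      unfolding c_def using pos[of n] by (intro root_growth_step C d) simp
    also have "\<dots> \<le> real (f (Suc n)) powr (1 / d)"
      using step[of n] C d by (intro powr_mono2) auto
    finally show ?case .
  qed simp
  have "(\<lambda>n. d * ln c / ln (real n)) \<longlonglongrightarrow> 0"
    by (intro real_tendsto_divide_at_top[OF tendsto_const]
      filterlim_compose[OF ln_at_top filterlim_real_sequentially])
  then have "(\<lambda>n. ereal (d * ln c / ln (real n) + d)) \<longlonglongrightarrow> ereal (0 + d)"
    by (intro tendsto_intros)
  then have "limsup (\<lambda>n. ereal (d * ln c / ln (real n) + d)) = ereal d"
    by (intro lim_imp_Limsup) simp_all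
  moreover have "limsup (\<lambda>n. ereal (d * ln c / ln (real n) + d))
      \<le> limsup (\<lambda>n. ereal (ln (real (f n)) / ln (real n)))"
  proof (rule Limsup_mono)
    show "eventually (\<lambda>n. ereal (d * ln c / ln (real n) + d) \<le> ereal (ln (real (f n)) / ln (real n)))
        sequentially"
      using eventually_ge_at_top[of 2]
    proof eventually_elim
      case (elim n)
      then have n: "ln (real n) > 0" by simp
      have "ln (c * real n) \<le> ln (real (f n) powr (1 / d))"
        using lower[of n] c elim pos[of n] by (subst ln_le_cancel_iff) auto
      then have "d * (ln c + ln (real n)) \<le> ln (real (f n))"
        using c elim d pos[of n] by (simp add: ln_mult field_simps)
      then have "d * (ln c + ln (real n)) / ln (real n) \<le> ln (real (f n)) / ln (real n)"
        using n by (intro divide_right_mono) auto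
      then show ?case using n by (simp add: distrib_left add_divide_distrib)
    qed
  qed
  ultimately show ?thesis by simp
qed

lemma limsup_log_ratio_le:
  fixes f :: "nat \<Rightarrow> nat" and A :: real
  assumes pos: "\<And>n. f n \<ge> 1" and bound: "\<And>n. n \<ge> 1 \<Longrightarrow> real (f n) \<le> A * real n ^ d"
  shows "limsup (\<lambda>n. ereal (ln (real (f n)) / ln (real n))) \<le> ereal (real d)"
proof -
  have A: "A > 0" using bound[of 1] pos[of 1] by simp
  have "(\<lambda>n. ln A / ln (real n)) \<longlonglongrightarrow> 0"
    by (intro real_tendsto_divide_at_top[OF tendsto_const]
      filterlim_compose[OF ln_at_top filterlim_real_sequentially])
  then have "(\<lambda>n. ereal (ln A / ln (real n) + real d)) \<longlonglongrightarrow> ereal (0 + real d)"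
    by (intro tendsto_intros)
  then have "limsup (\<lambda>n. ereal (ln A / ln (real n) + real d)) = ereal (real d)"
    by (intro lim_imp_Limsup) simp_all
  moreover have "limsup (\<lambda>n. ereal (ln (real (f n)) / ln (real n)))
      \<le> limsup (\<lambda>n. ereal (ln A / ln (real n) + real d))"
  proof (rule Limsup_mono)
    show "eventually (\<lambda>n. ereal (ln (real (f n)) / ln (real n)) \<le> ereal (ln A / ln (real n) + real d))
        sequentially"
      using eventually_ge_at_top[of 2]
    proof eventually_elim
      case (elim n)
      then have n: "ln (real n) > 0" by simp
      have "ln (real (f n)) \<le> ln (A * real n ^ d)"
        using bound[of n] pos[of n] A elim by (subst ln_le_cancel_iff) auto
      then have "ln (real (f n)) \<le> ln A + real d * ln (real n)"
        using A elim by (simp add: ln_mult ln_realpow)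
      then show ?case using n by (simp add: field_simps)
    qed
  qed
  ultimately show ?thesis by simp
qed

section \<open>An isoperimetric inequality for lattice points\<close>

definition raise :: "nat \<Rightarrow> nat list \<Rightarrow> nat list" where
  "raise i a = a[i := Suc (a ! i)]"

lemma raise_0_Cons [simp]: "raise 0 (h # t) = Suc h # t"
  by (simp add: raise_def)

lemma raise_Suc_Cons [simp]: "raise (Suc i) (h # t) = h # raise i t"
  by (simp add: raise_def)

lemma length_raise [simp]: "length (raise i a) = length a"
  by (simp add: raise_def)

text \<open>Translation respects the lexicographic order on exponents; this makes it compatible with leading
terms later on.\<close>

lemma raise_less:
  "length a = length b \<Longrightarrow> a < b \<Longrightarrow> raise i a < raise i b"
proof (induction a b arbitrary: i rule: list_induct2)
  case (Cons x xs y ys)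
  then show ?case by (cases i) auto
qed simp

definition raise_closure :: "nat \<Rightarrow> nat list set \<Rightarrow> nat list set" where
  "raise_closure d S = S \<union> (\<Union>i<d. raise i ` S)"

lemma finite_raise_closure: "finite S \<Longrightarrow> finite (raise_closure d S)"
  by (simp add: raise_closure_def)

text \<open>On every line in the first coordinate direction that meets \<open>S\<close>, the successor of the topmost point
is new. The lines that meet \<open>S\<close> correspond to the elements of \<open>tl ` S\<close>.\<close>

lemma card_raise_0_gain:
  assumes fin: "finite S" and len: "\<And>a. a \<in> S \<Longrightarrow> a \<noteq> []"
  shows "card S + card (tl ` S) \<le> card (S \<union> raise 0 ` S)"
proof -
  define top where "top t = Max {h. h # t \<in> S}" for t
  have finh: "finite {h. h # t \<in> S}" for t
    by (rule finite_subset[of _ "hd ` S"]) (force, simp add: fin)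
  have top: "top t # t \<in> S" "Suc (top t) # t \<notin> S" if "t \<in> tl ` S" for t
  proof -
    have ne: "{h. h # t \<in> S} \<noteq> {}" using that len by (force simp: neq_Nil_conv)
    show "top t # t \<in> S" using Max_in[OF finh ne] by (simp add: top_def)
    show "Suc (top t) # t \<notin> S" using Max_ge[OF finh, of "Suc (top t)" t] by (auto simp: top_def)
  qed
  let ?new = "(\<lambda>t. Suc (top t) # t) ` tl ` S"
  have "?new \<subseteq> raise 0 ` S" using top(1) by (force intro: image_eqI[where x = "top _ # _"])
  then have "card (S \<union> ?new) \<le> card (S \<union> raise 0 ` S)" using fin by (intro card_mono) auto
  moreover have "card (S \<union> ?new) = card S + card ?new"
    using fin top(2) by (intro card_Un_disjoint) auto
  moreover have "card ?new = card (tl ` S)" by (intro card_image) (simp add: inj_on_def)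
  ultimately show ?thesis by simp
qed

text \<open>The two lower bounds available in the induction step of the isoperimetric inequality balance at
\<open>p = N powr (n / (n + 1))\<close>; away from this value one of them is larger than needed.\<close>

lemma powr_isoperimetric_split:
  fixes N p n :: real
  assumes "n > 0" "p > 0" "N \<ge> 0"
  shows "N powr (n / (n + 1)) \<le> max p (N * p powr (- 1 / n))"
proof (cases "N = 0")
  case False
  then have N: "N > 0" using assms by simp
  show ?thesis
  proof (cases "N powr (n / (n + 1)) \<le> p")
    case False
    have "(N powr (n / (n + 1))) powr (- 1 / n) \<le> p powr (- 1 / n)"
      using False assms by (intro powr_mono2') auto
    then have "N powr (- 1 / (n + 1)) \<le> p powr (- 1 / n)"
      using assms by (simp add: powr_powr)
    then have "N * N powr (- 1 / (n + 1)) \<le> N * p powr (- 1 / n)"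
      using N by (intro mult_left_mono) auto
    moreover have "N * N powr (- 1 / (n + 1)) = N powr (n / (n + 1))"
    proof -
      have "n / (n + 1) = 1 + - 1 / (n + 1)" using assms by (simp add: field_simps)
      then show ?thesis using N by (simp only: powr_add) simp
    qed
    ultimately show ?thesis by simp
  qed simp
qed simp

text \<open>The entries of a list from position \<open>Suc d\<close> on are never moved, so \<open>S\<close> is a finite union of sets in
separate copies of a lattice. The proof is by induction on the dimension, slicing \<open>S\<close> by the first
coordinate. Let \<open>p\<close> be the size of the projection of \<open>S\<close> along this coordinate. Moving in the first
direction adds at least \<open>p\<close> points. Moving in the other directions adds, by induction, the sum of
the powers \<open>n\<^sub>h powr (d / (d + 1))\<close> of the sizes \<open>n\<^sub>h \<le> p\<close> of the slices, hence at least \<open>card S\<close> times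
\<open>p powr (- 1 / (d + 1))\<close>. One of the two is large enough.\<close>

lemma lattice_isoperimetric:
  assumes "finite S" "\<And>a. a \<in> S \<Longrightarrow> Suc d \<le> length a"
  shows "real (card (raise_closure (Suc d) S))
    \<ge> real (card S) + real (card S) powr (real d / real (Suc d))"
  using assms
proof (induction d arbitrary: S)
  case 0
  have "raise_closure (Suc 0) S = S \<union> raise 0 ` S" by (simp add: raise_closure_def lessThan_Suc)
  with 0 have "card S + card (tl ` S) \<le> card (raise_closure (Suc 0) S)"
    using card_raise_0_gain[of S] by force
  moreover have "real (card S) powr 0 \<le> real (card (tl ` S))"
    using 0 by (auto simp: Suc_le_eq card_gt_0_iff)
  ultimately show ?case by simp
next
  case (Suc d)
  have ne: "a \<noteq> []" if "a \<in> S" for a using Suc.prems(2)[OF that] by auto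
  define slice where "slice h = {t. h # t \<in> S}" for h
  define p where "p = card (tl ` S)"
  have slice_sub: "slice h \<subseteq> tl ` S" for h by (force simp: slice_def)
  have fin_slice: "finite (slice h)" for h
    using finite_subset[OF slice_sub] Suc.prems(1) by simp
  have S_eq: "S = (\<Union>h\<in>hd ` S. Cons h ` slice h)"
    using ne by (force simp: slice_def neq_Nil_conv)
  have card_layers: "card (\<Union>h\<in>hd ` S. Cons h ` X h) = (\<Sum>h\<in>hd ` S. card (X h))"
    if "\<And>h. finite (X h)" for X :: "nat \<Rightarrow> nat list set"
    using that Suc.prems(1)
    by (subst card_UN_disjoint) (auto simp: card_image intro!: sum.cong)
  have card_S: "card S = (\<Sum>h\<in>hd ` S. card (slice h))"
    using arg_cong[OF S_eq, of card] card_layers[of slice, OF fin_slice] by (rule trans)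
  let ?e = "real d / real (Suc d)"
  have "raise_closure (Suc (Suc d)) S \<supseteq> (\<Union>h\<in>hd ` S. Cons h ` raise_closure (Suc d) (slice h))"
    unfolding raise_closure_def slice_def by (force intro: rev_image_eqI)
  then have "card (\<Union>h\<in>hd ` S. Cons h ` raise_closure (Suc d) (slice h))
      \<le> card (raise_closure (Suc (Suc d)) S)"
    using Suc.prems(1) by (intro card_mono finite_raise_closure)
  then have "(\<Sum>h\<in>hd ` S. card (raise_closure (Suc d) (slice h)))
      \<le> card (raise_closure (Suc (Suc d)) S)"
    by (subst (asm) card_layers) (auto intro: finite_raise_closure fin_slice)
  then have "(\<Sum>h\<in>hd ` S. real (card (raise_closure (Suc d) (slice h))))
      \<le> real (card (raise_closure (Suc (Suc d)) S))"
    by (metis of_nat_mono of_nat_sum)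
  moreover have "(\<Sum>h\<in>hd ` S. real (card (slice h)) + real (card (slice h)) powr ?e)
      \<le> (\<Sum>h\<in>hd ` S. real (card (raise_closure (Suc d) (slice h))))"
    using Suc.prems(2) by (intro sum_mono Suc.IH fin_slice) (force simp: slice_def)
  ultimately have 1: "real (card S) + (\<Sum>h\<in>hd ` S. real (card (slice h)) powr ?e)
      \<le> real (card (raise_closure (Suc (Suc d)) S))"
    by (simp add: sum.distrib card_S)
  have "S \<union> raise 0 ` S \<subseteq> raise_closure (Suc (Suc d)) S" by (auto simp: raise_closure_def)
  then have "card S + p \<le> card (raise_closure (Suc (Suc d)) S)"
    unfolding p_def using card_raise_0_gain[OF Suc.prems(1) ne] Suc.prems(1)
    by (meson card_mono finite_raise_closure le_trans)
  then have 2: "real (card S) + real p \<le> real (card (raise_closure (Suc (Suc d)) S))"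
    by (metis of_nat_mono of_nat_add)
  have slice_gain: "real (card (slice h)) * real p powr (- 1 / real (Suc d)) \<le> real (card (slice h)) powr ?e"
    for h
  proof (cases "card (slice h) = 0")
    case False
    then have c: "real (card (slice h)) > 0" by simp
    have "card (slice h) \<le> p"
      unfolding p_def using slice_sub Suc.prems(1) by (intro card_mono) auto
    then have "real p powr (- 1 / real (Suc d)) \<le> real (card (slice h)) powr (- 1 / real (Suc d))"
      using c by (intro powr_mono2') auto
    then have "real (card (slice h)) * real p powr (- 1 / real (Suc d))
        \<le> real (card (slice h)) * real (card (slice h)) powr (- 1 / real (Suc d))"
      by (intro mult_left_mono) auto
    also have "\<dots> = real (card (slice h)) powr ?e"
    proof -
      have "?e = 1 + - 1 / real (Suc d)" by (simp add: field_simps)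
      then show ?thesis using c by (simp only: powr_add) simp
    qed
    finally show ?thesis .
  qed simp
  have "real (card S) * real p powr (- 1 / real (Suc d))
      \<le> (\<Sum>h\<in>hd ` S. real (card (slice h)) powr ?e)"
    unfolding card_S of_nat_sum sum_distrib_right by (intro sum_mono slice_gain)
  with 1 2 have 3: "real (card S) + max (real p) (real (card S) * real p powr (- 1 / real (Suc d)))
      \<le> real (card (raise_closure (Suc (Suc d)) S))"
    by simp
  show ?case
  proof (cases "S = {}")
    case False
    then have "p > 0" using Suc.prems(1) by (simp add: p_def card_gt_0_iff)
    then have "real (card S) powr (real (Suc d) / (real (Suc d) + 1))
        \<le> max (real p) (real (card S) * real p powr (- 1 / real (Suc d)))"
      by (intro powr_isoperimetric_split) auto
    moreover have "real (Suc d) + 1 = real (Suc (Suc d))" by simp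
    ultimately show ?thesis using 3 by (simp only:)
  qed simp
qed

section \<open>Linear independence over a set of coefficients\<close>

text \<open>The coefficients \<open>R\<close> are the scalars in some places and a polynomial ring inside the field in others.
Indexed families are used instead of sets, so that a repeated member counts as a dependence.\<close>

definition indep_family :: "'a::field set \<Rightarrow> ('i \<Rightarrow> 'a) \<Rightarrow> 'i set \<Rightarrow> bool" where
  "indep_family R e I \<longleftrightarrow>
    (\<forall>A f. finite A \<and> A \<subseteq> I \<and> (\<forall>i\<in>A. f i \<in> R) \<and> (\<Sum>i\<in>A. f i * e i) = 0 \<longrightarrow> (\<forall>i\<in>A. f i = 0))"

lemma indep_familyD:
  "\<lbrakk>indep_family R e I; finite A; A \<subseteq> I; \<And>i. i \<in> A \<Longrightarrow> f i \<in> R; (\<Sum>i\<in>A. f i * e i) = 0; i \<in> A\<rbrakk>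
    \<Longrightarrow> f i = 0"
  unfolding indep_family_def by blast

lemma indep_family_divide:
  assumes "indep_family R e I" "c \<noteq> 0"
  shows "indep_family R (\<lambda>i. e i / c) I"
  unfolding indep_family_def
proof safe
  fix A f i
  assume A: "finite A" "A \<subseteq> I" "\<forall>i\<in>A. f i \<in> R" "(\<Sum>i\<in>A. f i * (e i / c)) = 0" "i \<in> A"
  have "(\<Sum>i\<in>A. f i * e i) = c * (\<Sum>i\<in>A. f i * (e i / c))"
    using assms(2) by (simp add: sum_distrib_left)
  then show "f i = 0" using A by (intro indep_familyD[OF assms(1)]) auto
qed

lemma indep_family_reindex:
  assumes ind: "indep_family R e I" and inj: "inj_on h J" and sub: "h ` J \<subseteq> I"
  shows "indep_family R (\<lambda>j. e (h j)) J"
  unfolding indep_family_def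
proof safe
  fix A f j
  assume A: "finite A" "A \<subseteq> J" "\<forall>i\<in>A. f i \<in> R" "(\<Sum>i\<in>A. f i * e (h i)) = 0" "j \<in> A"
  have injA: "inj_on h A" using inj A(2) by (rule inj_on_subset)
  let ?f = "\<lambda>i. f (the_inv_into A h i)"
  have f: "?f (h i) = f i" if "i \<in> A" for i using the_inv_into_f_f[OF injA that] by simp
  have "(\<Sum>i\<in>h ` A. ?f i * e i) = (\<Sum>i\<in>A. f i * e (h i))"
    by (subst sum.reindex[OF injA]) (auto simp: f intro!: sum.cong)
  then have "?f (h j) = 0"
    using A sub f by (intro indep_familyD[OF ind, of "h ` A" ?f]) auto
  then show "f j = 0" using f A(5) by simp
qed

text \<open>The argument for the tower of bases of field extensions: group the terms of a relation by \<open>j\<close>, cancel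
first the coefficients in \<open>P\<close>, then those in \<open>R\<close>.\<close>

lemma indep_family_tower:
  assumes e: "indep_family R e I" and g: "indep_family P g J" and R0: "0 \<in> R"
    and comb: "\<And>A f. \<lbrakk>finite A; A \<subseteq> I; \<And>i. i \<in> A \<Longrightarrow> f i \<in> R\<rbrakk> \<Longrightarrow> (\<Sum>i\<in>A. f i * e i) \<in> P"
  shows "indep_family R (\<lambda>(i, j). e i * g j) (I \<times> J)"
  unfolding indep_family_def
proof safe
  fix A f i j
  assume A: "finite A" "A \<subseteq> I \<times> J" "\<forall>p\<in>A. f p \<in> R"
    and sum0: "(\<Sum>p\<in>A. f p * (case p of (i, j) \<Rightarrow> e i * g j)) = 0" and ij: "(i, j) \<in> A"
  define A1 A2 where "A1 = fst ` A" and "A2 = snd ` A"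
  define f' where "f' p = (if p \<in> A then f p else 0)" for p
  have fin: "finite A1" "finite A2" and sub: "A1 \<subseteq> I" "A2 \<subseteq> J" and AA: "A \<subseteq> A1 \<times> A2"
    using A(1,2) by (force simp: A1_def A2_def)+
  have f'R: "f' p \<in> R" for p using A(3) R0 by (simp add: f'_def)
  have "(\<Sum>j\<in>A2. (\<Sum>i\<in>A1. f' (i, j) * e i) * g j) = (\<Sum>i\<in>A1. \<Sum>j\<in>A2. f' (i, j) * (e i * g j))"
    by (subst sum.swap) (simp add: sum_distrib_right mult.assoc)
  also have "\<dots> = (\<Sum>p\<in>A1 \<times> A2. f' p * (case p of (i, j) \<Rightarrow> e i * g j))"
    by (simp add: sum.cartesian_product case_prod_unfold)
  also have "\<dots> = (\<Sum>p\<in>A. f p * (case p of (i, j) \<Rightarrow> e i * g j))"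
    using fin AA by (intro sum.mono_neutral_cong_right) (auto simp: f'_def)
  finally have outer: "(\<Sum>j\<in>A2. (\<Sum>i\<in>A1. f' (i, j) * e i) * g j) = 0" using sum0 by simp
  have j: "j \<in> A2" and i: "i \<in> A1" using ij by (force simp: A1_def A2_def)+
  have "(\<Sum>i\<in>A1. f' (i, j) * e i) = 0"
    by (rule indep_familyD[OF g fin(2) sub(2) _ outer j]) (intro comb fin sub f'R)
  then have "f' (i, j) = 0" by (intro indep_familyD[OF e fin(1) sub(1) f'R _ i])
  then show "f (i, j) = 0" using ij by (simp add: f'_def)
qed

text \<open>The exponent of the first variable is the head of the list. It is read off by \<^term>\<open>hd\<close> and
\<^term>\<open>tl\<close> so that adding a variable amounts to reindexing by \<open>a \<mapsto> (tl a, hd a)\<close>.\<close>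

fun monomial :: "'a::comm_monoid_mult list \<Rightarrow> nat list \<Rightarrow> 'a" where
  "monomial [] a = 1"
| "monomial (x # xs) a = monomial xs (tl a) * x ^ hd a"

lemma monomial_mult:
  "\<lbrakk>length a = length xs; length b = length xs\<rbrakk>
    \<Longrightarrow> monomial xs a * monomial xs b = monomial xs (map2 (+) a b)"
proof (induction xs arbitrary: a b)
  case (Cons x xs)
  then obtain m a' n b' where "a = m # a'" "b = n # b'" by (metis length_Suc_conv)
  with Cons show ?case by (simp add: power_add mult_ac flip: Cons.IH)
qed simp

lemma monomial_raise:
  "\<lbrakk>length a = length xs; i < length xs\<rbrakk> \<Longrightarrow> monomial xs (raise i a) = xs ! i * monomial xs a"
proof (induction xs arbitrary: a i)
  case (Cons x xs)
  then obtain m a' where "a = m # a'" by (metis length_Suc_conv)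
  with Cons show ?case by (cases i) (auto simp: mult_ac)
qed simp

lemma monomial_replicate_0 [simp]: "monomial xs (replicate (length xs) 0) = 1"
  by (induction xs) auto

context field_embedding
begin

lemma scalar_0: "\<iota> 0 = 0"
  using emb_add[of 0 0] by (metis add_cancel_right_right)

lemma scalar_sum_in_span:
  assumes "\<And>i. i \<in> A \<Longrightarrow> f i \<in> range \<iota>" "\<And>i. i \<in> A \<Longrightarrow> e i \<in> X"
  shows "(\<Sum>i\<in>A. f i * e i) \<in> span X"
proof (rule span_sum)
  fix i assume "i \<in> A"
  then show "f i * e i \<in> span X"
    using assms span_scale[OF span_base[of "e i" X]] by fastforce
qed

lemma span_image_expansion:
  assumes "w \<in> span (e ` B)"
  obtains A c where "finite A" "A \<subseteq> B" "w = (\<Sum>i\<in>A. \<iota> (c i) * e i)" "\<And>i. i \<in> A \<Longrightarrow> c i \<noteq> 0"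
proof -
  obtain t r where t: "finite t" "t \<subseteq> e ` B" "w = (\<Sum>v\<in>t. \<iota> (r v) * v)"
    using assms by (auto simp: span_explicit)
  obtain A where A: "A \<subseteq> B" "inj_on e A" "t = e ` A" using t(2) by (auto simp: subset_image_inj)
  have finA: "finite A" using t(1) A by (simp add: finite_image_iff)
  have "w = (\<Sum>i\<in>A. \<iota> (r (e i)) * e i)" by (simp add: t(3) A(3) sum.reindex[OF A(2)])
  also have "\<dots> = (\<Sum>i\<in>{i \<in> A. r (e i) \<noteq> 0}. \<iota> (r (e i)) * e i)"
    using finA by (intro sum.mono_neutral_right) (auto simp: scalar_0)
  finally show ?thesis using A(1) finA by (intro that[of "{i \<in> A. r (e i) \<noteq> 0}" "r \<circ> e"]) auto
qed

lemma indep_family_notin_span: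
  assumes ind: "indep_family (range \<iota>) e I" and a: "a \<in> I" and B: "B \<subseteq> I - {a}"
  shows "e a \<notin> span (e ` B)"
proof
  assume "e a \<in> span (e ` B)"
  then obtain A c where A: "finite A" "A \<subseteq> B" "e a = (\<Sum>i\<in>A. \<iota> (c i) * e i)"
    by (rule span_image_expansion)
  have aA: "a \<notin> A" using A(2) B by auto
  let ?f = "\<lambda>i. \<iota> (if i = a then 1 else - c i)"
  have neg: "\<iota> (- x) = - \<iota> x" for x
    using emb_add[of x "- x"] by (simp add: scalar_0 eq_neg_iff_add_eq_0 add.commute)
  have "(\<Sum>i\<in>insert a A. ?f i * e i) = e a + (\<Sum>i\<in>A. - (\<iota> (c i) * e i))"
    using A(1) aA by (auto simp: emb_one neg intro!: sum.cong)
  also have "\<dots> = 0" using A(3) by (simp add: sum_negf)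
  finally have "?f a = 0"
    using A(1,2) B a by (intro indep_familyD[OF ind, of "insert a A" ?f]) auto
  then show False by (simp add: emb_one)
qed

section \<open>Leading indices of the elements of a subspace\<close>

text \<open>For an independent family \<open>e\<close>, this says that a scalar multiple of \<open>e a\<close> is the leading term of \<open>w\<close>. Phrasing it by the
span of the smaller members avoids coordinates of \<open>w\<close>.\<close>

definition leads :: "('i::linorder \<Rightarrow> 'K) \<Rightarrow> 'i set \<Rightarrow> 'K \<Rightarrow> 'i \<Rightarrow> bool" where
  "leads e I w a \<longleftrightarrow> a \<in> I \<and> (\<exists>c. c \<noteq> 0 \<and> w - \<iota> c * e a \<in> span (e ` {b \<in> I. b < a}))"

definition leading_set :: "('i::linorder \<Rightarrow> 'K) \<Rightarrow> 'i set \<Rightarrow> 'K set \<Rightarrow> 'i set" where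
  "leading_set e I W = {a. \<exists>w\<in>W. leads e I w a}"

lemma leads_exists:
  assumes "w \<in> span (e ` B)" "B \<subseteq> I" "w \<noteq> 0"
  shows "\<exists>a\<in>B. leads e I w a"
proof -
  obtain A c where A: "finite A" "A \<subseteq> B" "w = (\<Sum>i\<in>A. \<iota> (c i) * e i)" and c: "\<And>i. i \<in> A \<Longrightarrow> c i \<noteq> 0"
    using span_image_expansion[OF assms(1)] by metis
  have ne: "A \<noteq> {}" using A(3) assms(3) by auto
  let ?a = "Max A"
  have a: "?a \<in> A" using A(1) ne by simp
  have "w - \<iota> (c ?a) * e ?a = (\<Sum>i\<in>A - {?a}. \<iota> (c i) * e i)"
    using A(1,3) a by (simp add: sum_diff1)
  also have "\<dots> \<in> span (e ` {b \<in> I. b < ?a})"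
    using A(1,2) assms(2) Max_ge[OF A(1)]
    by (intro scalar_sum_in_span) (auto simp: less_le)
  finally show ?thesis using a A(2) assms(2) c[OF a] by (auto simp: leads_def)
qed

text \<open>The member with the largest leading index is not a combination of the others, since these involve
only smaller indices.\<close>

lemma leads_independent:
  assumes ind: "indep_family (range \<iota>) e I"
    and "finite A" "\<And>a. a \<in> A \<Longrightarrow> leads e I (w a) a"
  shows "inj_on w A \<and> independent (w ` A)"
  using assms(2,3)
proof (induction A rule: finite_linorder_max_induct)
  case (insert b A)
  let ?U = "span (e ` {c \<in> I. c < b})"
  have "w a \<in> ?U" if "a \<in> A" for a
  proof -
    obtain c where c: "a \<in> I" "w a - \<iota> c * e a \<in> span (e ` {b \<in> I. b < a})"
      using insert.prems[of a] \<open>a \<in> A\<close> by (auto simp: leads_def)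
    have ab: "a < b" using insert.hyps(2) that by simp
    have "w a - \<iota> c * e a \<in> ?U" by (rule subsetD[OF span_mono c(2)]) (use ab in auto)
    moreover have "\<iota> c * e a \<in> ?U" using c(1) ab by (intro span_scale span_base) auto
    ultimately show ?thesis using span_add by fastforce
  qed
  then have sub: "span (w ` A) \<subseteq> ?U" by (intro span_minimal) auto
  have "w b \<notin> ?U"
  proof
    assume wb: "w b \<in> ?U"
    obtain c where c: "b \<in> I" "c \<noteq> 0" "w b - \<iota> c * e b \<in> ?U"
      using insert.prems[of b] by (auto simp: leads_def)
    have "w b - (w b - \<iota> c * e b) \<in> ?U" using wb c(3) by (rule span_diff)
    then have "\<iota> c * e b \<in> ?U" by simp
    then have "\<iota> (inverse c) * (\<iota> c * e b) \<in> ?U" by (rule span_scale)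
    moreover have "\<iota> (inverse c) * (\<iota> c * e b) = e b"
      using c(2) by (metis emb_mult emb_one left_inverse mult.assoc mult_1)
    ultimately have "e b \<in> ?U" by (simp only:)
    then show False using indep_family_notin_span[OF ind c(1), of "{c \<in> I. c < b}"] by auto
  qed
  then have "w b \<notin> span (w ` A)" using sub by blast
  then show ?case
    using insert span_base[of "w b" "w ` A"] by (auto simp: independent_insertI)
qed (simp add: independent_empty)

lemma card_leading_subset_le_dim:
  assumes ind: "indep_family (range \<iota>) e I" and T: "finite T" "W = span T"
    and A: "finite A" "A \<subseteq> leading_set e I W"
  shows "card A \<le> dim W"
proof -
  obtain w where w: "\<And>a. a \<in> A \<Longrightarrow> w a \<in> W \<and> leads e I (w a) a"
    using A(2) by (auto simp: leading_set_def subset_iff) metis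
  have "inj_on w A" "independent (w ` A)"
    using leads_independent[OF ind A(1), of w] w by auto
  then have "card A = dim (w ` A)" by (simp add: dim_eq_card_independent card_image)
  also have "\<dots> \<le> dim W" unfolding T(2) using w T by (intro dim_mono_finite) auto
  finally show ?thesis .
qed

lemma finite_leading_set:
  assumes "indep_family (range \<iota>) e I" "finite T" "W = span T"
  shows "finite (leading_set e I W)"
  using finite_if_finite_subsets_card_bdd[of "leading_set e I W" "dim W"]
    card_leading_subset_le_dim[OF assms] by simp

text \<open>Choose an element of \<open>W\<close> for each leading index. Subtracting a multiple of the chosen element from
\<open>u \<in> W\<close> lowers the leading index of \<open>u\<close> within the finite set of all leading indices, so that the chosen
elements span \<open>W\<close>.\<close>

lemma dim_le_card_leading_set:
  assumes ind: "indep_family (range \<iota>) e I" and T: "finite T" "W = span T"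
    and sub: "W \<subseteq> span (e ` I)"
  shows "dim W \<le> card (leading_set e I W)"
proof -
  let ?L = "leading_set e I W"
  have fin: "finite ?L" using ind T by (rule finite_leading_set)
  have "\<forall>a\<in>?L. \<exists>w. w \<in> W \<and> leads e I w a" by (auto simp: leading_set_def)
  from bchoice[OF this] obtain w where w: "\<And>a. a \<in> ?L \<Longrightarrow> w a \<in> W \<and> leads e I (w a) a" by blast
  have reduce: "u \<in> span (w ` ?L)" if "u \<in> W" "leads e I u a" for u a
    using that
  proof (induction "card {b \<in> ?L. b < a}" arbitrary: u a rule: less_induct)
    case less
    let ?U = "span (e ` {b \<in> I. b < a})"
    have aL: "a \<in> ?L" using less.prems by (auto simp: leading_set_def)
    obtain c where c: "c \<noteq> 0" "u - \<iota> c * e a \<in> ?U" using less.prems by (auto simp: leads_def)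
    obtain c' where c': "c' \<noteq> 0" "w a - \<iota> c' * e a \<in> ?U" using w[OF aL] by (auto simp: leads_def)
    define u' where "u' = u - \<iota> (c / c') * w a"
    have "u' = (u - \<iota> c * e a) - \<iota> (c / c') * (w a - \<iota> c' * e a)"
      using c' by (simp add: u'_def algebra_simps flip: emb_mult)
    then have u'U: "u' \<in> ?U" using c(2) c'(2) by (auto intro!: span_diff span_scale)
    have u'W: "u' \<in> W" unfolding u'_def
      using less.prems(1) w[OF aL] T(2) by (auto intro!: span_diff span_scale)
    have "u' \<in> span (w ` ?L)"
    proof (cases "u' = 0")
      case False
      then obtain b where b: "b \<in> I" "b < a" "leads e I u' b"
        using leads_exists[OF u'U, of I] by auto
      have "b \<in> ?L" using b(3) u'W by (auto simp: leading_set_def)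
      then have "card {x \<in> ?L. x < b} < card {x \<in> ?L. x < a}"
        using b(2) fin by (intro psubset_card_mono) auto
      then show ?thesis using u'W b(3) by (rule less.hyps)
    qed (simp add: span_zero)
    moreover have "\<iota> (c / c') * w a \<in> span (w ` ?L)" using aL by (intro span_scale span_base) auto
    ultimately have "u' + \<iota> (c / c') * w a \<in> span (w ` ?L)" by (rule span_add)
    then show ?case by (simp add: u'_def)
  qed
  have "W \<subseteq> span (w ` ?L)"
  proof
    fix u assume u: "u \<in> W"
    show "u \<in> span (w ` ?L)"
    proof (cases "u = 0")
      case False
      then obtain a where "leads e I u a" using leads_exists[of u e I I] u sub by auto
      then show ?thesis using u by (rule reduce[rotated])
    qed (simp add: span_zero)
  qed
  then have "dim W \<le> card (w ` ?L)" using fin by (intro dim_le_card) auto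
  then show ?thesis using card_image_le[OF fin, of w] by simp
qed

lemma leads_mult:
  assumes w: "leads e I w a"
    and s: "\<And>b. b \<in> I \<Longrightarrow> s b \<in> I \<and> e (s b) = x * e b" "\<And>b. b \<in> I \<Longrightarrow> b < a \<Longrightarrow> s b < s a"
  shows "leads e I (x * w) (s a)"
proof -
  obtain c where c: "a \<in> I" "c \<noteq> 0" "w - \<iota> c * e a \<in> span (e ` {b \<in> I. b < a})"
    using w by (auto simp: leads_def)
  have "x * (w - \<iota> c * e a) \<in> span (e ` {b \<in> I. b < s a})"
  proof (rule span_mult_mem[OF subspace_span _ span_base[of x "{x}"] c(3)])
    fix y z assume "y \<in> {x}" "z \<in> e ` {b \<in> I. b < a}"
    then obtain b where b: "b \<in> I" "b < a" "y * z = e (s b)" using s(1) by auto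
    have "s b \<in> {b \<in> I. b < s a}" using s b by blast
    then show "y * z \<in> span (e ` {b \<in> I. b < s a})" unfolding b(3) by (intro span_base imageI)
  qed simp
  then show ?thesis using s(1)[OF c(1)] c(2)
    by (auto simp: leads_def algebra_simps intro!: exI[of _ c])
qed

section \<open>Finitely generated modules over a subalgebra of the field\<close>

text \<open>Every finitely generated module over a domain \<open>P\<close> inside the field is contained in a free one of finite
rank. If a new element \<open>t\<close> is independent of the basis \<open>g\<close> found so far, it joins the basis. Otherwise
there is a relation in which \<open>t\<close> has a nonzero coefficient \<open>p\<close>; dividing the whole basis by \<open>p\<close>
keeps it independent and makes \<open>t\<close> a combination with coefficients in \<open>P\<close>.\<close>

lemma free_envelope:
  assumes P: "subalgebra P" and "finite T"
  shows "\<exists>(r::nat) g. indep_family P g {..<r} \<and> T \<subseteq> span {p * g j | p j. p \<in> P \<and> j < r}"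
  using assms(2)
proof (induction T rule: finite_induct)
  case empty
  show ?case by (auto simp: indep_family_def intro!: exI[of _ 0])
next
  case (insert t T)
  then obtain r :: nat and g where g: "indep_family P g {..<r}"
    and T: "T \<subseteq> span {p * g j | p j. p \<in> P \<and> j < r}" by blast
  have P1: "1 \<in> P" and Pmult: "\<And>x y. x \<in> P \<Longrightarrow> y \<in> P \<Longrightarrow> x * y \<in> P" and Psub: "subspace P"
    using P by (auto simp: subalgebra_def)
  let ?h = "g(r := t)"
  show ?case
  proof (cases "indep_family P ?h {..<Suc r}")
    case True
    have "{p * g j | p j. p \<in> P \<and> j < r} \<subseteq> {p * ?h j | p j. p \<in> P \<and> j < Suc r}" by force
    then have "T \<subseteq> span {p * ?h j | p j. p \<in> P \<and> j < Suc r}" using T span_mono by blast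
    moreover have "t = 1 * ?h r" by simp
    then have "t \<in> {p * ?h j | p j. p \<in> P \<and> j < Suc r}" using P1 by blast
    ultimately show ?thesis using True by (blast intro: span_base)
  next
    case False
    then obtain A f i where A: "finite A" "A \<subseteq> {..<Suc r}" and f: "\<And>i. i \<in> A \<Longrightarrow> f i \<in> P"
      and sum0: "(\<Sum>i\<in>A. f i * ?h i) = 0" and i: "i \<in> A" "f i \<noteq> 0"
      unfolding indep_family_def by blast
    have less: "j < r" if "j \<in> A - {r}" for j using that A(2) by fastforce
    have sum_eq: "(\<Sum>i\<in>A - {r}. f i * ?h i) = (\<Sum>i\<in>A - {r}. f i * g i)"
      by (intro sum.cong) auto
    have r: "r \<in> A \<and> f r \<noteq> 0"
    proof (rule ccontr)
      assume neg: "\<not> (r \<in> A \<and> f r \<noteq> 0)"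
      then have "(\<Sum>i\<in>A - {r}. f i * ?h i) = (\<Sum>i\<in>A. f i * ?h i)"
        using A(1) by (intro sum.mono_neutral_left) auto
      moreover have "i \<in> A - {r}" using neg i by auto
      ultimately have "f i = 0"
        using A(1) f less sum_eq sum0 by (intro indep_familyD[OF g, of "A - {r}" f]) auto
      then show False using i(2) by simp
    qed
    let ?g = "\<lambda>j. g j / f r"
    let ?X = "{p * ?g j | p j. p \<in> P \<and> j < r}"
    have "f r * t + (\<Sum>i\<in>A - {r}. f i * g i) = 0"
      using sum0 A(1) r sum_eq by (simp add: sum.remove[of A r])
    then have "t = - (\<Sum>i\<in>A - {r}. f i * g i) / f r"
      using r by (simp add: field_simps eq_neg_iff_add_eq_0)
    then have "t = - (\<Sum>i\<in>A - {r}. f i * ?g i)" by (simp add: sum_divide_distrib)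
    also have "\<dots> \<in> span ?X"
      using f less by (intro span_neg span_sum span_base) blast
    finally have t: "t \<in> span ?X" .
    have "p * g j \<in> ?X" if "p \<in> P" "j < r" for p j
    proof -
      have "p * g j = (p * f r) * ?g j" using r by simp
      then show ?thesis using Pmult[OF that(1) f[of r]] r that(2) by blast
    qed
    then have "span {p * g j | p j. p \<in> P \<and> j < r} \<subseteq> span ?X" by (intro span_mono) auto
    moreover have "indep_family P ?g {..<r}" using g r by (intro indep_family_divide) auto
    ultimately show ?thesis using T t by (intro exI[of _ r] exI[of _ ?g]) auto
  qed
qed


section \<open>Polynomials in algebraically independent elements\<close>

definition alg_indep :: "'K list \<Rightarrow> bool" where
  "alg_indep xs \<longleftrightarrow> indep_family (range \<iota>) (monomial xs) {a. length a = length xs}"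

definition polys :: "'K list \<Rightarrow> 'K set" where
  "polys xs = span (monomial xs ` {a. length a = length xs})"

lemma monomial_in_polys: "length a = length xs \<Longrightarrow> monomial xs a \<in> polys xs"
  unfolding polys_def by (rule span_base) simp

lemma subalgebra_polys: "subalgebra (polys xs)"
  unfolding subalgebra_def
proof (intro conjI ballI)
  show "subspace (polys xs)" by (simp add: polys_def)
  show "1 \<in> polys xs"
    using monomial_in_polys[of "replicate (length xs) 0" xs] by simp
  fix x y assume "x \<in> polys xs" "y \<in> polys xs"
  then show "x * y \<in> polys xs"
    unfolding polys_def
  proof (rule span_mult_mem[OF subspace_span, rotated])
    fix u v assume "u \<in> monomial xs ` {a. length a = length xs}" "v \<in> monomial xs ` {a. length a = length xs}"
    then obtain a b where "length a = length xs" "length b = length xs"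
      and "u * v = monomial xs (map2 (+) a b)" by (auto simp: monomial_mult)
    then show "u * v \<in> span (monomial xs ` {a. length a = length xs})"
      using monomial_in_polys[of "map2 (+) a b" xs] by (simp add: polys_def)
  qed
qed

lemma polys_mult: "x \<in> polys xs \<Longrightarrow> y \<in> polys xs \<Longrightarrow> x * y \<in> polys xs"
  using subalgebra_polys by (auto simp: subalgebra_def)

lemma one_in_polys: "1 \<in> polys xs"
  using subalgebra_polys by (auto simp: subalgebra_def)

lemma polys_Cons: "polys xs \<subseteq> polys (x # xs)"
  unfolding polys_def
proof (rule span_mono, safe)
  fix a :: "nat list" assume "length a = length xs"
  then show "monomial xs a \<in> monomial (x # xs) ` {a. length a = length (x # xs)}"
    by (intro image_eqI[of _ _ "0 # a"]) auto
qed

lemma head_in_polys: "x \<in> polys (x # xs)"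
  using monomial_in_polys[of "1 # replicate (length xs) 0" "x # xs"] by simp

lemma scalar_comb_in_polys:
  assumes "A \<subseteq> {a. length a = length xs}" "\<And>a. a \<in> A \<Longrightarrow> f a \<in> range \<iota>"
  shows "(\<Sum>a\<in>A. f a * monomial xs a) \<in> polys xs"
  unfolding polys_def using assms by (intro scalar_sum_in_span) auto

lemma alg_indep_Nil: "alg_indep []"
  unfolding alg_indep_def indep_family_def
proof safe
  fix A f i assume A: "A \<subseteq> {a. length a = length ([] :: 'K list)}" "(\<Sum>a\<in>A. f a * monomial [] a) = (0 :: 'K)" "i \<in> A"
  then have "A = {[]}" by auto
  then show "f i = 0" using A by simp
qed

lemma alg_indep_tower:
  assumes xs: "alg_indep xs" and g: "indep_family (polys xs) g J"
  shows "indep_family (range \<iota>) (\<lambda>(a, j). monomial xs a * g j) ({a. length a = length xs} \<times> J)"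
  using xs g unfolding alg_indep_def
  by (rule indep_family_tower) (auto intro: scalar_comb_in_polys rev_image_eqI[of 0] simp: scalar_0)

text \<open>Independence of the powers of \<open>y\<close> over \<open>polys xs\<close> means that \<open>y\<close> is transcendental over the field
generated by \<open>xs\<close>.\<close>

lemma alg_indep_Cons:
  assumes "alg_indep xs" "indep_family (polys xs) (\<lambda>n. y ^ n) UNIV"
  shows "alg_indep (y # xs)"
proof -
  have "inj_on (\<lambda>a. (tl a, hd a)) {a :: nat list. length a = length (y # xs)}"
    by (auto simp: inj_on_def length_Suc_conv)
  from indep_family_reindex[OF alg_indep_tower[OF assms] this]
  have "indep_family (range \<iota>) (\<lambda>a. monomial xs (tl a) * y ^ hd a) {a. length a = length (y # xs)}"
    by (simp add: image_subset_iff)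
  moreover have "monomial (y # xs) = (\<lambda>a. monomial xs (tl a) * y ^ hd a)" by (rule ext) simp
  ultimately show ?thesis unfolding alg_indep_def by (simp only:)
qed

section \<open>The isoperimetric inequality for algebraically independent elements\<close>

text \<open>A basis of the free module with generators \<open>g 0, \<dots>, g (r - 1)\<close> over \<open>polys xs\<close>. The index lists the
exponents of \<open>xs\<close> first and the number of the generator last. The generator can then be kept in the
same list as the exponents, where a single lexicographic order compares both, and
\<^term>\<open>raise i\<close> with \<open>i < length xs\<close> does not change it.\<close>

definition free_monomial :: "'K list \<Rightarrow> (nat \<Rightarrow> 'K) \<Rightarrow> nat list \<Rightarrow> 'K" where
  "free_monomial xs g a = monomial xs (butlast a) * g (last a)"

definition free_indices :: "'K list \<Rightarrow> nat \<Rightarrow> nat list set" where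
  "free_indices xs r = {a. length a = Suc (length xs) \<and> last a < r}"

lemma spanned_by_free_monomials:
  assumes xs: "alg_indep xs" and T: "finite T"
  shows "\<exists>r g. indep_family (range \<iota>) (free_monomial xs g) (free_indices xs r)
    \<and> T \<subseteq> span (free_monomial xs g ` free_indices xs r)"
proof -
  obtain r :: nat and g where g: "indep_family (polys xs) g {..<r}"
    and sub: "T \<subseteq> span {p * g j | p j. p \<in> polys xs \<and> j < r}"
    using free_envelope[OF subalgebra_polys T] by blast
  let ?I = "free_indices xs r" and ?e = "free_monomial xs g"
  have inj: "inj_on (\<lambda>a. (butlast a, last a)) ?I"
  proof (rule inj_onI)
    fix a b assume "a \<in> ?I" "b \<in> ?I" and eq: "(butlast a, last a) = (butlast b, last b)"
    then have "a \<noteq> []" "b \<noteq> []" by (auto simp: free_indices_def)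
    then show "a = b" using eq by (metis Pair_inject append_butlast_last_id)
  qed
  have e: "?e = (\<lambda>a. case (butlast a, last a) of (a, j) \<Rightarrow> monomial xs a * g j)"
    by (rule ext) (simp add: free_monomial_def)
  have ind: "indep_family (range \<iota>) ?e ?I"
    unfolding e using alg_indep_tower[OF xs g] inj
    by (rule indep_family_reindex) (auto simp: free_indices_def)
  have "p * g j \<in> span (?e ` ?I)" if p: "p \<in> polys xs" and j: "j < r" for p j
  proof (rule span_mult_mem[OF subspace_span _ p[unfolded polys_def] span_base[of "g j" "{g j}"]])
    fix x y assume "x \<in> monomial xs ` {a. length a = length xs}" "y \<in> {g j}"
    then obtain a where a: "length a = length xs" "x = monomial xs a" "y = g j" by auto
    have "?e (a @ [j]) \<in> span (?e ` ?I)"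
      using a(1) j by (intro span_base imageI) (simp add: free_indices_def)
    then show "x * y \<in> span (?e ` ?I)" using a by (simp add: free_monomial_def)
  qed simp
  then have "{p * g j | p j. p \<in> polys xs \<and> j < r} \<subseteq> span (?e ` ?I)" by blast
  then have "span {p * g j | p j. p \<in> polys xs \<and> j < r} \<subseteq> span (?e ` ?I)"
    by (rule span_minimal) (rule subspace_span)
  with sub have "T \<subseteq> span (?e ` ?I)" by (rule order_trans)
  with ind show ?thesis by blast
qed

lemma last_raise: "Suc i < length a \<Longrightarrow> last (raise i a) = last a"
  by (cases "a = []") (auto simp: raise_def last_conv_nth)

lemma free_indices_raise: "a \<in> free_indices xs r \<Longrightarrow> i < length xs \<Longrightarrow> raise i a \<in> free_indices xs r"
  by (simp add: free_indices_def last_raise)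

lemma free_monomial_raise:
  assumes a: "a \<in> free_indices xs r" and i: "i < length xs"
  shows "free_monomial xs g (raise i a) = xs ! i * free_monomial xs g a"
proof -
  have "butlast (raise i a) = raise i (butlast a)" "last (raise i a) = last a"
    using a i by (auto simp: raise_def free_indices_def butlast_list_update nth_butlast intro!: last_raise[unfolded raise_def])
  then show ?thesis
    using a i by (simp add: free_monomial_def monomial_raise free_indices_def mult.assoc)
qed

lemma sprod_span: "sprod (span A) (span B) = span {a * b | a b. a \<in> A \<and> b \<in> B}"
proof
  have "v * w \<in> span {a * b | a b. a \<in> A \<and> b \<in> B}" if "v \<in> span A" "w \<in> span B" for v w
    by (rule span_mult_mem[OF subspace_span _ that]) (rule span_base, blast)
  then show "sprod (span A) (span B) \<subseteq> span {a * b | a b. a \<in> A \<and> b \<in> B}"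
    unfolding sprod_def by (intro span_minimal subspace_span) blast
  show "span {a * b | a b. a \<in> A \<and> b \<in> B} \<subseteq> sprod (span A) (span B)"
    unfolding sprod_def by (rule span_mono) (blast intro: span_base)
qed

text \<open>Leading indices turn the dimension of \<open>W\<close> into the size of a finite set of lattice points, and
multiplication by the \<open>i\<close>-th variable into the translation \<^term>\<open>raise i\<close>. The lattice inequality
then applies to the leading indices of \<open>W\<close>.\<close>

lemma alg_indep_isoperimetric:
  assumes xs: "alg_indep xs" and ne: "xs \<noteq> []" and W: "subframe W"
  defines "V \<equiv> span (insert 1 (set xs))"
  shows "real (dim (sprod V W))
    \<ge> real (dim W) + real (dim W) powr ((real (length xs) - 1) / real (length xs))"
proof -
  obtain T where T: "finite T" "W = span T" using W by (auto simp: subframe_def)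
  obtain d' where d': "length xs = Suc d'" using ne by (cases xs) auto
  from spanned_by_free_monomials[OF xs T(1)] obtain r g where
    "indep_family (range \<iota>) (free_monomial xs g) (free_indices xs r)"
    "T \<subseteq> span (free_monomial xs g ` free_indices xs r)" by blast
  moreover define I e where "I = free_indices xs r" and "e = free_monomial xs g"
  ultimately have ind: "indep_family (range \<iota>) e I" and TI: "T \<subseteq> span (e ` I)" by simp_all
  have WI: "W \<subseteq> span (e ` I)" unfolding T(2) using TI by (intro span_minimal) auto
  have T': "finite {a * b | a b. a \<in> insert 1 (set xs) \<and> b \<in> T}"
    using T(1) by (intro finite_image_set2) auto
  have VW: "sprod V W = span {a * b | a b. a \<in> insert 1 (set xs) \<and> b \<in> T}"
    unfolding V_def T(2) by (rule sprod_span)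
  let ?L = "leading_set e I W"
  have finL: "finite ?L" using ind T by (rule finite_leading_set)
  have len: "Suc d' \<le> length a" if "a \<in> ?L" for a
    using that by (simp add: leading_set_def leads_def I_def free_indices_def d')
  have "raise_closure (Suc d') ?L \<subseteq> leading_set e I (sprod V W)"
  proof
    fix b assume "b \<in> raise_closure (Suc d') ?L"
    then consider "b \<in> ?L" | i a where "i < Suc d'" "a \<in> ?L" "b = raise i a"
      unfolding raise_closure_def by blast
    then show "b \<in> leading_set e I (sprod V W)"
    proof cases
      case 1
      then obtain w where w: "w \<in> W" "leads e I w b" unfolding leading_set_def by blast
      have "1 \<in> V" unfolding V_def by (rule span_base) simp
      from sprod_mem[OF this w(1)] w(2) show ?thesis by (auto simp: leading_set_def)
    next
      case 2
      then have i: "i < length xs" by (simp add: d')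
      obtain w where w: "w \<in> W" "leads e I w a" using 2(2) unfolding leading_set_def by blast
      have "leads e I (xs ! i * w) (raise i a)"
      proof (rule leads_mult[OF w(2)])
        fix b assume b: "b \<in> I"
        then show "raise i b \<in> I \<and> e (raise i b) = xs ! i * e b"
          using i free_indices_raise free_monomial_raise by (simp add: I_def e_def)
        assume "b < a"
        moreover have "length b = length a"
          using b w(2) by (simp add: leads_def I_def free_indices_def)
        ultimately show "raise i b < raise i a" by (intro raise_less)
      qed
      moreover have "xs ! i \<in> V" unfolding V_def using i by (intro span_base) simp
      ultimately show ?thesis
        using sprod_mem[of "xs ! i" V w W] w(1) unfolding leading_set_def 2(3) by blast
    qed
  qed
  then have "card (raise_closure (Suc d') ?L) \<le> dim (sprod V W)"
    using finL by (intro card_leading_subset_le_dim[OF ind T' VW] finite_raise_closure)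
  then have "real (card (raise_closure (Suc d') ?L)) \<le> real (dim (sprod V W))" by simp
  moreover have "real (card ?L) + real (card ?L) powr (real d' / real (Suc d'))
      \<le> real (card (raise_closure (Suc d') ?L))"
    by (rule lattice_isoperimetric[OF finL len])
  moreover have "card ?L = dim W"
    using card_leading_subset_le_dim[OF ind T finL order_refl] dim_le_card_leading_set[OF ind T WI]
    by (rule order_antisym)
  ultimately have "real (dim W) + real (dim W) powr (real d' / real (Suc d')) \<le> real (dim (sprod V W))"
    by (simp only:)
  moreover have "real d' / real (Suc d') = (real (length xs) - 1) / real (length xs)"
    by (simp add: d')
  ultimately show ?thesis by simp
qed

lemma Ld_star_nonneg: "0 \<le> Ld_star"
proof -
  have "subframe (span {1})" by (auto simp: subframe_def intro: span_base)
  then have "VDI_star (span {1}) \<le> Ld_star" unfolding Ld_star_def by (intro SUP_upper) simp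
  moreover have "0 \<le> VDI_star (span {1})" unfolding VDI_star_def by (intro Sup_upper) simp
  ultimately show ?thesis by (rule order_trans[rotated])
qed

lemma alg_indep_le_Ld_star:
  assumes xs: "alg_indep xs"
  shows "ereal (real (length xs)) \<le> Ld_star"
proof (cases "xs = []")
  case True
  then show ?thesis using Ld_star_nonneg by (simp add: zero_ereal_def)
next
  case False
  let ?V = "span (insert 1 (set xs))"
  have V: "subframe ?V" by (auto simp: subframe_def intro!: span_base exI[of _ "insert 1 (set xs)"])
  have "real (max (dim (sprod ?V W)) (dim (sprod W ?V)))
      \<ge> real (dim W) + 1 * real (dim W) powr ((real (length xs) - 1) / real (length xs))"
    if "subframe W" for W
    using alg_indep_isoperimetric[OF xs False that] by simp
  then have "\<exists>C>0. \<forall>W. subframe W \<longrightarrow> real (max (dim (sprod ?V W)) (dim (sprod W ?V)))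
      \<ge> real (dim W) + C * real (dim W) powr ((real (length xs) - 1) / real (length xs))"
    by (intro exI[of _ "1::real"]) simp
  then have "ereal (real (length xs)) \<le> VDI_star ?V"
    unfolding VDI_star_def using False by (intro Sup_upper) simp
  also have "VDI_star ?V \<le> Ld_star" unfolding Ld_star_def using V by (intro SUP_upper) simp
  finally show ?thesis .
qed


section \<open>The strong lower transcendence degree is at most the growth\<close>

lemma sprod_commute: "sprod A B = sprod B A"
proof -
  have "{v * w | v w. v \<in> A \<and> w \<in> B} = {v * w | v w. v \<in> B \<and> w \<in> A}"
    by (rule Collect_cong) (metis mult.commute)
  then show ?thesis by (simp add: sprod_def)
qed

text \<open>The isoperimetric inequality for \<open>V\<close> is used only against the powers of \<open>V\<close>.\<close>

lemma Ld_star_le_GKdim: "Ld_star \<le> GKdim"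
  unfolding Ld_star_def
proof (intro SUP_least)
  fix V assume "V \<in> {V. subframe V}"
  then have V: "subframe V" by simp
  have pos: "dim (spower V n) \<ge> 1" for n using V by (rule dim_spower_pos)
  have frame: "subframe (spower V n)" for n
    using V subspace_spower one_mem_spower finite_spanning_spower[OF V] by (auto simp: subframe_def)
  have GK: "growth_exponent V \<le> GKdim"
  proof -
    have "GKdim_fg (subalgebra hull V) \<le> GKdim"
      unfolding GKdim_def using V fg_subalgebra_iff by (intro SUP_upper) blast
    then show ?thesis using GKdim_fg_eq[OF V refl] by simp
  qed
  have nonneg: "0 \<le> growth_exponent V"
    unfolding growth_exponent_def
  proof (rule order_trans[OF _ Liminf_le_Limsup])
    show "0 \<le> liminf (\<lambda>n. ereal (ln (real (dim (spower V n))) / ln (real n)))"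
    proof (intro Liminf_bounded eventually_mono[OF eventually_ge_at_top[of 1]])
      fix n :: nat assume "1 \<le> n"
      then show "0 \<le> ereal (ln (real (dim (spower V n))) / ln (real n))"
        using pos[of n] by simp
    qed
  qed simp
  have "ereal d \<le> growth_exponent V"
    if "d > 0" and C: "C > 0" and iso: "\<forall>W. subframe W \<longrightarrow>
        real (max (dim (sprod V W)) (dim (sprod W V))) \<ge> real (dim W) + C * real (dim W) powr ((d - 1) / d)"
    for C d
    unfolding growth_exponent_def
  proof (rule limsup_log_ratio_ge[OF C \<open>d > 0\<close> pos])
    fix n
    show "real (dim (spower V (Suc n)))
        \<ge> real (dim (spower V n)) + C * real (dim (spower V n)) powr ((d - 1) / d)"
      using iso[rule_format, OF frame[of n]] by (simp add: sprod_commute[of "spower V n" V])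
  qed
  then have "VDI_star V \<le> growth_exponent V"
    unfolding VDI_star_def using nonneg by (intro Sup_least) blast
  then show "VDI_star V \<le> GKdim" using GK by (rule order_trans)
qed

section \<open>The growth is at most the strong lower transcendence degree\<close>

text \<open>The elements of \<open>S\<close> are added one by one. An element that is transcendental over \<open>polys xs\<close>
joins \<open>xs\<close>. For an algebraic element \<open>y\<close> with a relation of degree \<open>e\<close> and leading coefficient
\<open>p\<close>, replace \<open>B\<close> by the products \<open>b * y ^ n\<close> with \<open>n < e\<close>, and \<open>q\<close> by \<open>q * p\<close>: the relation
rewrites \<open>p * y ^ e\<close> in terms of lower powers. Thus \<open>q\<close> is a common denominator for the action of \<open>S\<close>
on the module generated by \<open>B\<close>.\<close>

lemma finite_over_alg_indep:
  assumes "finite S"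
  shows "\<exists>xs B q. alg_indep xs \<and> finite B \<and> 1 \<in> B \<and> q \<in> polys xs \<and> q \<noteq> 0 \<and>
    (\<forall>s\<in>S. \<forall>b\<in>B. q * s * b \<in> sprod (polys xs) B)"
  using assms
proof (induction S rule: finite_induct)
  case empty
  have "alg_indep [] \<and> finite {1 :: 'K} \<and> 1 \<in> {1 :: 'K} \<and> 1 \<in> polys [] \<and> (1 :: 'K) \<noteq> 0"
    using alg_indep_Nil one_in_polys by simp
  then show ?case by blast
next
  case (insert y S)
  then obtain xs B q where xs: "alg_indep xs" and B: "finite B" "1 \<in> B"
    and q: "q \<in> polys xs" "q \<noteq> 0" and S: "\<And>s b. s \<in> S \<Longrightarrow> b \<in> B \<Longrightarrow> q * s * b \<in> sprod (polys xs) B"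
    by blast
  let ?P = "polys xs"
  show ?case
  proof (cases "indep_family ?P (\<lambda>n. y ^ n) UNIV")
    case True
    have "q * s * b \<in> sprod (polys (y # xs)) B" if "s \<in> insert y S" "b \<in> B" for s b
    proof (cases "s \<in> S")
      case True
      then show ?thesis using S[OF True that(2)] sprod_mono[OF polys_Cons order_refl] by blast
    next
      case False
      then have "s = y" using that(1) by simp
      moreover have "q * y \<in> polys (y # xs)"
        using q(1) polys_Cons head_in_polys by (blast intro: polys_mult)
      ultimately show ?thesis using that(2) by (simp add: sprod_mem)
    qed
    moreover have "q \<in> polys (y # xs)" using q(1) polys_Cons by blast
    ultimately show ?thesis using alg_indep_Cons[OF xs True] B q(2) by blast
  next
    case False
    then obtain A f i where A: "finite A" and f: "\<And>n. n \<in> A \<Longrightarrow> f n \<in> ?P"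
      and sum0: "(\<Sum>n\<in>A. f n * y ^ n) = 0" and i: "i \<in> A" "f i \<noteq> 0"
      unfolding indep_family_def by blast
    define A' where "A' = {n \<in> A. f n \<noteq> 0}"
    have A': "finite A'" "A' \<noteq> {}" using A i by (auto simp: A'_def)
    define e where "e = Max A'"
    have e: "e \<in> A" "f e \<noteq> 0" using Max_in[OF A'] by (auto simp: A'_def e_def)
    have less: "n < e" if "n \<in> A' - {e}" for n
      using Max_ge[OF A'(1), of n] that by (auto simp: e_def)
    have "(\<Sum>n\<in>A'. f n * y ^ n) = 0"
      unfolding A'_def using sum0 A by (subst sum.mono_neutral_left[of A]) auto
    then have top: "f e * y ^ e = - (\<Sum>n\<in>A' - {e}. f n * y ^ n)"
      using A'(1) Max_in[OF A'] by (simp add: sum.remove[of A' e] e_def eq_neg_iff_add_eq_0)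
    \<comment> \<open>A relation of degree \<open>0\<close> would say that its only coefficient vanishes.\<close>
    have e0: "e > 0"
    proof (rule ccontr)
      assume "\<not> e > 0"
      then have "e = 0" "A' - {e} = {}" using less by blast+
      then show False using top e(2) by (metis add.inverse_neutral mult_1_right power_0 sum.empty)
    qed
    define B' where "B' = {b * y ^ n | b n. b \<in> B \<and> n < e}"
    let ?q = "q * f e"
    have q': "?q \<in> ?P" "?q \<noteq> 0" using polys_mult q e f by auto
    have B': "finite B'" unfolding B'_def using B(1) by (intro finite_image_set2) auto
    have "1 * y ^ 0 \<in> B'" unfolding B'_def using B(2) e0 by blast
    then have 1: "1 \<in> B'" by simp
    have sub: "subspace (sprod ?P B')" by (simp add: sprod_def)
    have mem: "p * (b * y ^ n) \<in> sprod ?P B'" if "p \<in> ?P" "b \<in> B" "n < e" for p b n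
      using that by (intro sprod_mem) (auto simp: B'_def)
    have "?q * s * (b * y ^ n) \<in> sprod ?P B'" if s: "s \<in> insert y S" and b: "b \<in> B" and n: "n < e" for s b n
    proof (cases "s \<in> S")
      case True
      have "f e * y ^ n * (q * s * b) \<in> sprod ?P B'"
      proof (rule span_mult_mem[OF sub _ span_base[of _ "{f e * y ^ n}"] S[OF True b, unfolded sprod_def]])
        fix u v assume "u \<in> {f e * y ^ n}" "v \<in> {v * w | v w. v \<in> ?P \<and> w \<in> B}"
        then obtain p c where c: "p \<in> ?P" "c \<in> B" "u * v = (f e * p) * (c * y ^ n)" by (auto simp: mult_ac)
        then show "u * v \<in> sprod ?P B'" using mem[of "f e * p" c n] polys_mult f e(1) n by simp
      qed simp
      then show ?thesis by (simp add: mult_ac)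
    next
      case False
      then have [simp]: "s = y" using s by simp
      show ?thesis
      proof (cases "Suc n < e")
        case True
        then show ?thesis using mem[OF q'(1) b True] by (simp add: mult_ac)
      next
        case False
        then have "Suc n = e" using n by simp
        then have "?q * s * (b * y ^ n) = q * b * (f e * y ^ e)" by (auto simp: mult_ac)
        also have "\<dots> = - (\<Sum>m\<in>A' - {e}. (q * f m) * (b * y ^ m))"
          unfolding top by (simp add: sum_distrib_left mult_ac)
        also have "\<dots> \<in> sprod ?P B'"
        proof (intro subspace_neg[OF sub] subspace_sum[OF sub])
          fix m assume m: "m \<in> A' - {e}"
          then have "f m \<in> ?P" using f by (simp add: A'_def)
          then show "(q * f m) * (b * y ^ m) \<in> sprod ?P B'"
            using q(1) by (intro mem polys_mult b less[OF m])
        qed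
        finally show ?thesis .
      qed
    qed
    then have "\<forall>s\<in>insert y S. \<forall>b\<in>B'. ?q * s * b \<in> sprod ?P B'" unfolding B'_def by blast
    then show ?thesis using xs B' 1 q' by blast
  qed
qed

text \<open>Bounding each exponent instead of the total degree changes the count of monomials only by a constant
factor and makes it a plain power.\<close>

definition box_monomials :: "'K list \<Rightarrow> nat \<Rightarrow> 'K set" where
  "box_monomials xs N = monomial xs ` {a. set a \<subseteq> {..N} \<and> length a = length xs}"

lemma box_monomials_mono: "M \<le> N \<Longrightarrow> box_monomials xs M \<subseteq> box_monomials xs N"
  unfolding box_monomials_def by (intro image_mono) fastforce

lemma finite_box_monomials: "finite (box_monomials xs N)"
  unfolding box_monomials_def by (intro finite_imageI finite_lists_length_eq) simp

lemma card_box_monomials: "card (box_monomials xs N) \<le> Suc N ^ length xs"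
  unfolding box_monomials_def
  using card_image_le[OF finite_lists_length_eq[of "{..N}" "length xs"], of "monomial xs"]
  by (simp add: card_lists_length_eq)

lemma box_monomials_mult:
  assumes "u \<in> box_monomials xs M" "v \<in> box_monomials xs N"
  shows "u * v \<in> box_monomials xs (M + N)"
proof -
  obtain a b where a: "u = monomial xs a" "set a \<subseteq> {..M}" "length a = length xs"
    and b: "v = monomial xs b" "set b \<subseteq> {..N}" "length b = length xs"
    using assms by (auto simp: box_monomials_def)
  have "x + y \<le> M + N" if "(x, y) \<in> set (zip a b)" for x y
    using set_zip_leftD[OF that] set_zip_rightD[OF that] a(2) b(2) by (intro add_mono) auto
  then have "set (map2 (+) a b) \<subseteq> {..M + N}" by auto
  then show ?thesis using a b by (auto simp: box_monomials_def monomial_mult)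
qed

lemma one_in_box_monomials: "1 \<in> box_monomials xs N"
  unfolding box_monomials_def by (rule image_eqI[of _ _ "replicate (length xs) 0"]) auto

lemma sprod_polys_bounded:
  assumes "x \<in> sprod (polys xs) B"
  shows "\<exists>N. x \<in> sprod (box_monomials xs N) B"
proof -
  let ?U = "\<Union>N. sprod (box_monomials xs N) B"
  have inc: "sprod (box_monomials xs M) B \<subseteq> sprod (box_monomials xs N) B" if "M \<le> N" for M N
    using that by (intro sprod_mono box_monomials_mono) auto
  have U: "subspace ?U"
  proof (rule subspaceI)
    show "0 \<in> ?U" by (auto simp: sprod_def span_zero)
    fix x y assume "x \<in> ?U" "y \<in> ?U"
    then obtain M N where "x \<in> sprod (box_monomials xs M) B" "y \<in> sprod (box_monomials xs N) B" by blast
    then have "x \<in> sprod (box_monomials xs (max M N)) B" "y \<in> sprod (box_monomials xs (max M N)) B"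
      using inc[of M "max M N"] inc[of N "max M N"] by auto
    then have "x + y \<in> sprod (box_monomials xs (max M N)) B" by (simp add: sprod_def span_add)
    then show "x + y \<in> ?U" by blast
  next
    fix c x assume "x \<in> ?U"
    then obtain M where "x \<in> sprod (box_monomials xs M) B" by blast
    then have "\<iota> c * x \<in> sprod (box_monomials xs M) B" by (simp add: sprod_def span_scale)
    then show "\<iota> c * x \<in> ?U" by blast
  qed
  have "p * b \<in> ?U" if p: "p \<in> polys xs" and b: "b \<in> B" for p b
  proof (rule span_mult_mem[OF U _ p[unfolded polys_def] span_base[of b "{b}"]])
    fix u v assume "u \<in> monomial xs ` {a. length a = length xs}" "v \<in> {b}"
    then obtain a where a: "u = monomial xs a" "length a = length xs" "v = b" by auto
    have "u \<in> box_monomials xs (sum_list a)"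
      using a member_le_sum_list by (auto simp: box_monomials_def)
    then show "u * v \<in> ?U" using sprod_mem[of u _ b B] a(3) b by blast
  qed simp
  then have "sprod (polys xs) B \<subseteq> ?U" unfolding sprod_def[of "polys xs"] using U by (intro span_minimal) auto
  then show ?thesis using assms by blast
qed

text \<open>Let \<open>M N\<close> be the span of the products of elements of \<open>B\<close> with monomials having exponents at most
\<open>N\<close>. Multiplication by \<open>q * s\<close>, for \<open>s \<in> S\<close>, maps \<open>M N\<close> into \<open>M (N + D)\<close> with \<open>D\<close> independent of
\<open>N\<close>. So the \<open>n\<close>-th power of \<open>q\<close> maps the \<open>n\<close>-th power of \<open>V\<close> into \<open>M (n * D)\<close>, whose dimension
is at most a constant times the \<open>d\<close>-th power of \<open>n\<close>, where \<open>d = length xs\<close>.\<close>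

lemma growth_exponent_le:
  assumes V: "subframe V" "V = span S" and S: "finite S" and B: "finite B" "1 \<in> B"
    and q: "q \<noteq> 0" and SB: "\<And>s b. s \<in> S \<Longrightarrow> b \<in> B \<Longrightarrow> q * s * b \<in> sprod (polys xs) B"
  shows "growth_exponent V \<le> ereal (real (length xs))"
proof -
  define M where "M N = sprod (box_monomials xs N) B" for N
  have M_mono: "M k \<subseteq> M N" if "k \<le> N" for k N
    unfolding M_def using that by (intro sprod_mono box_monomials_mono) auto
  have subM: "subspace (M N)" for N by (simp add: M_def sprod_def)
  have "\<forall>p\<in>S \<times> B. \<exists>N. q * fst p * snd p \<in> M N"
    using SB sprod_polys_bounded by (auto simp: M_def)
  from bchoice[OF this] obtain N where N: "\<And>s b. s \<in> S \<Longrightarrow> b \<in> B \<Longrightarrow> q * s * b \<in> M (N (s, b))" by force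
  \<comment> \<open>The sum serves as a common upper bound of finitely many exponents.\<close>
  define D where "D = (\<Sum>p\<in>S \<times> B. N p)"
  have D: "q * s * b \<in> M D" if "s \<in> S" "b \<in> B" for s b
  proof -
    have "N (s, b) \<le> D" unfolding D_def using that S B(1) by (intro member_le_sum) auto
    then show ?thesis using N[OF that] M_mono by blast
  qed
  have step: "q * s * m \<in> M (k + D)" if s: "s \<in> S" and m: "m \<in> M k" for s m k
  proof (rule span_mult_mem[OF subM _ span_base[of _ "{q * s}"] m[unfolded M_def sprod_def]])
    fix x y assume "x \<in> {q * s}" "y \<in> {v * w | v w. v \<in> box_monomials xs k \<and> w \<in> B}"
    then obtain u b where u: "u \<in> box_monomials xs k" and b: "b \<in> B" and xy: "x * y = u * (q * s * b)"
      by (auto simp: mult_ac)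
    show "x * y \<in> M (k + D)" unfolding xy
    proof (rule span_mult_mem[OF subM _ span_base[of u "{u}"] D[OF s b, unfolded M_def sprod_def]])
      fix x y assume "x \<in> {u}" "y \<in> {v * w | v w. v \<in> box_monomials xs D \<and> w \<in> B}"
      then obtain u' c where "x * y = (u * u') * c" "u' \<in> box_monomials xs D" "c \<in> B"
        by (auto simp: mult_ac)
      then show "x * y \<in> M (k + D)"
        unfolding M_def using box_monomials_mult[OF u] by (simp add: sprod_mem)
    qed simp
  qed simp
  have pow: "q ^ n * x \<in> M (n * D)" if "x \<in> spower V n" for n x
    using that
  proof (induction n arbitrary: x)
    case 0
    have "1 \<in> M 0" unfolding M_def using sprod_mem[OF one_in_box_monomials B(2)] by simp
    then have "span {1} \<subseteq> M 0" using subM by (intro span_minimal) auto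
    then show ?case using 0 by auto
  next
    case (Suc n)
    let ?U = "{x. q ^ Suc n * x \<in> M (Suc n * D)}"
    have U: "subspace ?U"
      using subM[of "Suc n * D"] by (auto simp: subspace_def distrib_left mult_scale_right)
    have "v * w \<in> ?U" if v: "v \<in> V" and w: "w \<in> spower V n" for v w
    proof (rule span_mult_mem[OF U _ v[unfolded V(2)] span_base[of w "{w}"]])
      fix s w' assume "s \<in> S" "w' \<in> {w}"
      then have "q * s * (q ^ n * w') \<in> M (n * D + D)" using step Suc.IH[OF w] by blast
      moreover have "q * s * (q ^ n * w') = q ^ Suc n * (s * w')" by simp
      ultimately show "s * w' \<in> ?U" by (simp add: add.commute)
    qed simp
    then have "sprod V (spower V n) \<subseteq> ?U" unfolding sprod_def using U by (intro span_minimal) auto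
    then show ?case using Suc.prems by auto
  qed
  have dim_le: "dim (spower V n) \<le> card B * Suc (n * D) ^ length xs" for n
  proof -
    let ?G = "(\<lambda>(u, b). u * b / q ^ n) ` (box_monomials xs (n * D) \<times> B)"
    have "spower V n \<subseteq> span ?G"
    proof
      fix x assume "x \<in> spower V n"
      from pow[OF this] have m: "q ^ n * x \<in> M (n * D)" .
      have "inverse (q ^ n) * (q ^ n * x) \<in> span ?G"
      proof (rule span_mult_mem[OF subspace_span _ span_base[of _ "{inverse (q ^ n)}"] m[unfolded M_def sprod_def]])
        fix y z assume "y \<in> {inverse (q ^ n)}" "z \<in> {v * w | v w. v \<in> box_monomials xs (n * D) \<and> w \<in> B}"
        then obtain u b where "u \<in> box_monomials xs (n * D)" "b \<in> B" "y * z = u * b / q ^ n"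
          by (auto simp: divide_inverse mult_ac)
        then show "y * z \<in> span ?G" by (intro span_base) auto
      qed simp
      moreover have "inverse (q ^ n) * (q ^ n * x) = x" using q by (simp flip: mult.assoc)
      ultimately show "x \<in> span ?G" by (simp only:)
    qed
    then have "dim (spower V n) \<le> card ?G" using B(1) finite_box_monomials by (intro dim_le_card) auto
    also have "\<dots> \<le> card (box_monomials xs (n * D) \<times> B)"
      using B(1) finite_box_monomials by (intro card_image_le) auto
    also have "\<dots> \<le> card B * Suc (n * D) ^ length xs"
      using card_box_monomials[of xs "n * D"] by (simp add: card_cartesian_product)
    finally show ?thesis .
  qed
  show ?thesis unfolding growth_exponent_def
  proof (rule limsup_log_ratio_le[OF dim_spower_pos[OF V(1)]])
    fix n :: nat assume n: "n \<ge> 1"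
    have "Suc (n * D) ^ length xs \<le> (Suc D * n) ^ length xs"
      using n by (intro power_mono) auto
    then have "dim (spower V n) \<le> card B * (Suc D * n) ^ length xs"
      using dim_le[of n] by (meson le_trans mult_le_mono2)
    then have "real (dim (spower V n)) \<le> real (card B * (Suc D * n) ^ length xs)"
      by (rule of_nat_mono)
    then show "real (dim (spower V n)) \<le> (real (card B) * real (Suc D) ^ length xs) * real n ^ length xs"
      by (simp only: of_nat_mult of_nat_power power_mult_distrib mult.assoc)
  qed
qed

lemma GKdim_le_Ld_star: "GKdim \<le> Ld_star"
  unfolding GKdim_def
proof (intro SUP_least)
  fix A assume "A \<in> {B. fg_subalgebra B}"
  then obtain V where V: "subframe V" "subalgebra hull V = A" by (auto simp: fg_subalgebra_iff)
  then obtain S where S: "finite S" "V = span S" by (auto simp: subframe_def)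
  obtain xs B q where xs: "alg_indep xs" and "finite B" "1 \<in> B" "q \<noteq> 0"
    and "\<And>s b. s \<in> S \<Longrightarrow> b \<in> B \<Longrightarrow> q * s * b \<in> sprod (polys xs) B"
    using finite_over_alg_indep[OF S(1)] by blast
  then have "growth_exponent V \<le> ereal (real (length xs))"
    by (intro growth_exponent_le[OF V(1) S(2,1)])
  also have "\<dots> \<le> Ld_star" using xs by (rule alg_indep_le_Ld_star)
  finally show "GKdim_fg A \<le> Ld_star" using GKdim_fg_eq[OF V] by simp
qed

end

theorem corollary3p2:
  fixes \<iota> :: "'k::field \<Rightarrow> 'K::field"
  assumes "field_embedding \<iota>"
  shows "k_algebra.Ld_star (\<lambda>c x. \<iota> c * x) = k_algebra.GKdim (\<lambda>c x. \<iota> c * x)"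
proof -
  interpret field_embedding \<iota> by (rule assms)
  show ?thesis by (rule order_antisym[OF Ld_star_le_GKdim GKdim_le_Ld_star])
qed

end
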